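(* Let $u:[0,1]\to\mathbb{R}$ be piecewise continuous, continuous on $\bigcup_{i=0}^{N-1}(t_i,t_{i+1})$ with $0=t_0<t_1<\dots<t_N=1$. Let $w_*$ be a solution of Problem $(W)$. Then $w_*$ is continuously differentiable at each discontinuity of $u$ and satisfies the integral Euler equation together with the natural boundary conditions: $$w_*'(t)=\int_0^t -\tfrac14\,u(s)\cos(w_*(s))\,ds\quad\text{for a.e. } t\in[0,1],\qquad w_*'(0)=w_*'(1)=0.$$
   Context: Piecewise continuous: $u:[0,1]\to\mathbb{R}$ is piecewise continuous if there are $0=t_0<t_1<\dots<t_N=1$ such that $u$ is continuous on each $(t_i,t_{i+1})$, $i=0,\dots,N-1$, the left limits of $u$ exist and are finite at $t_1,\dots,t_N$, and the right limits exist and are finite at $t_0,\dots,t_{N-1}$. Problem $(W)$: minimize over absolutely continuous $w:[0,1]\to[-\frac{\pi}{2},\frac{\pi}{2}]$ (here $\pi=3.14159\ldots$) the functional $$J^W[w]=\int_0^1\left((w'(t))^2-u(t)\,\frac{1+\sin(w(t))}{2}\right)dt.$$ A solution is a $w_*$ with $J^W[w_*]<+\infty$ and $J^W[w_*]\le J^W[w]$ for all absolutely continuous $w:[0,1]\to[-\frac{\pi}{2},\frac{\pi}{2}]$. Derivatives at the endpoints $0,1$ are one-sided. *)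

theory Defs
  imports "HOL-Analysis.Analysis"
begin

text \<open>
  Functions on \<open>[0,1]\<close> are represented by total functions on the reals. Derivatives are taken
  within \<open>{0..1}\<close>, so that nothing below depends on values outside \<open>[0,1]\<close> and derivatives at
  the endpoints are one-sided.
\<close>

definition piecewise_continuous_wrt :: "nat \<Rightarrow> (nat \<Rightarrow> real) \<Rightarrow> (real \<Rightarrow> real) \<Rightarrow> bool" where
  "piecewise_continuous_wrt N t u \<longleftrightarrow>
     t 0 = 0 \<and> t N = 1 \<and> (\<forall>i<N. t i < t (Suc i)) \<and>
     (\<forall>i<N. continuous_on {t i<..<t (Suc i)} u) \<and>
     (\<forall>i\<in>{1..N}. \<exists>l. (u \<longlongrightarrow> l) (at_left (t i))) \<and>
     (\<forall>i<N. \<exists>l. (u \<longlongrightarrow> l) (at_right (t i)))"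

text \<open>
  The usual epsilon-delta notion. A division of a subset of \<open>S\<close> is a finite family of compact
  intervals \<open>K = {Inf K..Sup K}\<close> contained in \<open>S\<close> with pairwise disjoint interiors.
\<close>

definition absolutely_continuous_on :: "real set \<Rightarrow> (real \<Rightarrow> real) \<Rightarrow> bool" where
  "absolutely_continuous_on S f \<longleftrightarrow>
     (\<forall>\<epsilon>>0. \<exists>\<delta>>0. \<forall>D T. D division_of T \<and> T \<subseteq> S \<and> (\<Sum>K\<in>D. Sup K - Inf K) < \<delta> \<longrightarrow>
        (\<Sum>K\<in>D. \<bar>f (Sup K) - f (Inf K)\<bar>) < \<epsilon>)"

text \<open>
  The Lebesgue integral as the integral of the positive part minus the integral of the negative
  part (\<open>ennreal\<close> truncates negative reals to 0). The Bochner integral is not suitable for the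
  functional below, because it is 0 when the positive part has infinite integral.
\<close>

definition extended_integral :: "'a measure \<Rightarrow> ('a \<Rightarrow> real) \<Rightarrow> ereal" where
  "extended_integral M f =
     enn2ereal (\<integral>\<^sup>+x. ennreal (f x) \<partial>M) - enn2ereal (\<integral>\<^sup>+x. ennreal (- f x) \<partial>M)"

lemma extended_integral_eq_integral:
  assumes "integrable M f"
  shows "extended_integral M f = ereal (integral\<^sup>L M f)"
proof -
  from assms obtain r q where rq: "0 \<le> r" "0 \<le> q"
    "(\<integral>\<^sup>+x. ennreal (f x) \<partial>M) = ennreal r" "(\<integral>\<^sup>+x. ennreal (- f x) \<partial>M) = ennreal q"
    "integral\<^sup>L M f = r - q"
    by (rule integrableE)
  then show ?thesis
    by (simp add: extended_integral_def enn2ereal_ennreal)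
qed

text \<open>
  An absolutely continuous \<open>w\<close> is differentiable almost everywhere, so the unspecified value of
  \<open>vector_derivative\<close> at points of non-differentiability does not affect the functional. The
  negative part of the integrand is bounded when \<open>u\<close> is, so that \<open>\<infinity> - \<infinity>\<close> does not occur.
\<close>

definition JW :: "(real \<Rightarrow> real) \<Rightarrow> (real \<Rightarrow> real) \<Rightarrow> ereal" where
  "JW u w = extended_integral (lebesgue_on {0..1})
     (\<lambda>t. (vector_derivative w (at t within {0..1}))\<^sup>2 - u t * ((1 + sin (w t)) / 2))"

definition admissible_W :: "(real \<Rightarrow> real) \<Rightarrow> bool" where
  "admissible_W w \<longleftrightarrow> absolutely_continuous_on {0..1} w \<and> w \<in> {0..1} \<rightarrow> {- pi / 2..pi / 2}"

definition solution_W :: "(real \<Rightarrow> real) \<Rightarrow> (real \<Rightarrow> real) \<Rightarrow> bool" where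
  "solution_W u w \<longleftrightarrow>
     admissible_W w \<and> JW u w < \<infinity> \<and> (\<forall>v. admissible_W v \<longrightarrow> JW u w \<le> JW u v)"

text \<open>
  Continuous differentiability at a point: the derivative exists and is continuous on a relative
  neighbourhood of the point.
\<close>

definition C1_at_within :: "(real \<Rightarrow> real) \<Rightarrow> real \<Rightarrow> real set \<Rightarrow> bool" where
  "C1_at_within f x S \<longleftrightarrow>
     (\<exists>e>0. (\<forall>s\<in>S \<inter> ball x e. f differentiable (at s within S)) \<and>
            continuous_on (S \<inter> ball x e) (\<lambda>s. vector_derivative f (at s within S)))"

end

theory Submission
  imports Defs
begin

text \<open>
  Folding values beyond \<open>\<plusminus> pi / 2\<close> back by reflection is 1-Lipschitz and preserves the sine, so
  a solution \<open>w\<close> also minimizes among the unconstrained competitors \<open>w + e \<eta>\<close> with \<open>e\<close> small.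
  This gives the weak Euler equation \<open>\<integral> w' \<eta>' = - \<integral> c \<eta>\<close> for \<open>c = - u cos w / 4\<close> and every absolutely
  continuous \<open>\<eta>\<close> with square integrable derivative. Let \<open>G\<close> be the primitive of \<open>c\<close> vanishing at 0.
  Taking \<open>\<eta> = 1\<close> gives \<open>G 1 = 0\<close>; integrating by parts with \<open>\<eta> x = w x - w 0 - \<integral>\<^sub>0\<^sup>x G\<close>,
  for which \<open>\<eta>' = w' - G\<close>, gives \<open>\<integral> (w' - G)\<^sup>2 = 0\<close>. Hence \<open>w\<close> is a primitive of the continuous function
  \<open>G\<close>, and is \<open>C\<^sup>1\<close> on all of \<open>[0,1]\<close>.

  The fundamental theorem of calculus for an absolutely continuous function comes from
  writing it as a difference of two nondecreasing ones by means of its variation, applying the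
  Radon-Nikodym theorem to their Stieltjes measures, and differentiating the integral
  of the density.
\<close>

subsection \<open>Variation of an absolutely continuous function\<close>

text \<open>
  Families of nondegenerate intervals, each represented by its pair of endpoints. Excluding the
  one-point intervals that divisions allow makes unions over disjoint families add up exactly.
\<close>

definition nonoverlapping :: "real \<Rightarrow> real \<Rightarrow> (real \<times> real) set \<Rightarrow> bool" where
  "nonoverlapping a b D \<longleftrightarrow> finite D \<and> (\<forall>p\<in>D. a \<le> fst p \<and> fst p < snd p \<and> snd p \<le> b) \<and>
     pairwise (\<lambda>p q. snd p \<le> fst q \<or> snd q \<le> fst p) D"

definition var_sum :: "(real \<Rightarrow> real) \<Rightarrow> (real \<times> real) set \<Rightarrow> real" where
  "var_sum f D = (\<Sum>p\<in>D. \<bar>f (snd p) - f (fst p)\<bar>)"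

text \<open>Absolute continuity with divisions replaced by \<open>nonoverlapping\<close> families,
  which can be cut, extended and nested by operating on endpoints.\<close>

definition ac_pairs :: "real \<Rightarrow> real \<Rightarrow> (real \<Rightarrow> real) \<Rightarrow> bool" where
  "ac_pairs a b f \<longleftrightarrow> (\<forall>\<epsilon>>0. \<exists>\<delta>>0. \<forall>D. nonoverlapping a b D \<and> (\<Sum>p\<in>D. snd p - fst p) < \<delta> \<longrightarrow>
     var_sum f D < \<epsilon>)"

text \<open>A real supremum, hence informative only once the sums are bounded;
  \<open>ac_pairs_bounded_variation\<close> supplies this. The empty family keeps the set of sums
  nonempty in every case.\<close>

definition variation :: "(real \<Rightarrow> real) \<Rightarrow> real \<Rightarrow> real \<Rightarrow> real" where
  "variation f a b = Sup (var_sum f ` Collect (nonoverlapping a b))"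

section \<open>Length, cutting and enlarging of interval families\<close>

text \<open>Open intervals are genuinely disjoint where closed ones could share an endpoint, so
  finite additivity of Lebesgue measure applies. Bounds on total length then follow from inclusions
  of sets.\<close>

lemma nonoverlapping_length_eq:
  assumes "nonoverlapping a b D"
  shows "(\<Sum>p\<in>D. snd p - fst p) = measure lborel (\<Union>p\<in>D. {fst p<..<snd p})"
proof -
  have fin: "finite D" and D: "\<And>p. p \<in> D \<Longrightarrow> a \<le> fst p \<and> fst p < snd p \<and> snd p \<le> b"
    and pw: "pairwise (\<lambda>p q. snd p \<le> fst q \<or> snd q \<le> fst p) D"
    using assms by (auto simp: nonoverlapping_def)
  have dis: "disjoint_family_on (\<lambda>p. {fst p<..<snd p}) D"
    unfolding disjoint_family_on_def
  proof (intro ballI impI)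
    fix p q assume "p \<in> D" "q \<in> D" "p \<noteq> q"
    then have "snd p \<le> fst q \<or> snd q \<le> fst p" using pw by (auto simp: pairwise_def)
    then show "{fst p<..<snd p} \<inter> {fst q<..<snd q} = {}" by auto
  qed
  have "(\<Sum>p\<in>D. snd p - fst p) = (\<Sum>p\<in>D. measure lborel {fst p<..<snd p})"
    using D by (intro sum.cong) (auto simp: less_imp_le)
  also have "\<dots> = measure lborel (\<Union>p\<in>D. {fst p<..<snd p})"
  proof (rule measure_finite_Union[symmetric, OF fin _ dis])
    show "emeasure lborel {fst p<..<snd p} \<noteq> \<infinity>" if "p \<in> D" for p
      using D[OF that] by simp
  qed auto
  finally show ?thesis .
qed

lemma nonoverlapping_length_le:
  assumes "nonoverlapping a b D" "a \<le> b"
  shows "(\<Sum>p\<in>D. snd p - fst p) \<le> b - a"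
proof -
  have "measure lborel (\<Union>p\<in>D. {fst p<..<snd p}) \<le> measure lborel {a..b}"
  proof (rule measure_mono_fmeasurable)
    show "(\<Union>p\<in>D. {fst p<..<snd p}) \<subseteq> {a..b}"
      using assms(1) by (fastforce simp: nonoverlapping_def)
    show "(\<Union>p\<in>D. {fst p<..<snd p}) \<in> sets lborel" by (simp add: borel_open open_UN)
    show "{a..b} \<in> fmeasurable lborel" by (simp add: fmeasurable_def emeasure_lborel_Icc_eq)
  qed
  then show ?thesis using assms by (simp add: nonoverlapping_length_eq)
qed

text \<open>Every interval is cut at \<open>b\<close>. Only an interval with \<open>b\<close> in its
  interior is changed, and the triangle inequality bounds its increment by those of its two
  pieces.\<close>

lemma nonoverlapping_split:
  assumes "nonoverlapping a c D" "a \<le> b" "b \<le> c"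
  obtains D1 D2 where "nonoverlapping a b D1" "nonoverlapping b c D2"
    "var_sum f D \<le> var_sum f D1 + var_sum f D2"
proof -
  have fin: "finite D" and D: "\<And>p. p \<in> D \<Longrightarrow> a \<le> fst p \<and> fst p < snd p \<and> snd p \<le> c"
    and pw: "\<And>p q. p \<in> D \<Longrightarrow> q \<in> D \<Longrightarrow> p \<noteq> q \<Longrightarrow> snd p \<le> fst q \<or> snd q \<le> fst p"
    using assms by (auto simp: nonoverlapping_def pairwise_def)
  define l where "l p = (fst p, min (snd p) b)" for p :: "real \<times> real"
  define r where "r p = (max (fst p) b, snd p)" for p :: "real \<times> real"
  define A where "A = {p\<in>D. fst p < b}"
  define B where "B = {p\<in>D. b < snd p}"
  \<comment> \<open>\<open>l\<close> keeps left endpoints, and distinct nonoverlapping nondegenerate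
    intervals cannot share one. So no two members collapse and the sums below can be reindexed;
    \<open>r\<close> is symmetric.\<close>
  have injl: "inj_on l A"
  proof (rule inj_onI, rule ccontr)
    fix p q assume "p \<in> A" "q \<in> A" "l p = l q" "p \<noteq> q"
    then have "p \<in> D" "q \<in> D" "fst p = fst q" by (auto simp: A_def l_def)
    then show False using pw[of p q] D[of p] D[of q] \<open>p \<noteq> q\<close> by auto
  qed
  have injr: "inj_on r B"
  proof (rule inj_onI, rule ccontr)
    fix p q assume "p \<in> B" "q \<in> B" "r p = r q" "p \<noteq> q"
    then have "p \<in> D" "q \<in> D" "snd p = snd q" by (auto simp: B_def r_def)
    then show False using pw[of p q] D[of p] D[of q] \<open>p \<noteq> q\<close> by auto
  qed
  show thesis
  proof (rule that)
    show "nonoverlapping a b (l ` A)"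
      unfolding nonoverlapping_def pairwise_image
    proof (intro conjI ballI)
      show "finite (l ` A)" using fin by (simp add: A_def)
      show "pairwise (\<lambda>x y. l x \<noteq> l y \<longrightarrow> snd (l x) \<le> fst (l y) \<or> snd (l y) \<le> fst (l x)) A"
      proof (rule pairwiseI)
        fix p q assume "p \<in> A" "q \<in> A" "p \<noteq> q"
        then show "l p \<noteq> l q \<longrightarrow> snd (l p) \<le> fst (l q) \<or> snd (l q) \<le> fst (l p)"
          using pw[of p q] by (auto simp: A_def l_def)
      qed
    qed (use D in \<open>auto simp: A_def l_def\<close>)
    show "nonoverlapping b c (r ` B)"
      unfolding nonoverlapping_def pairwise_image
    proof (intro conjI ballI)
      show "finite (r ` B)" using fin by (simp add: B_def)
      show "pairwise (\<lambda>x y. r x \<noteq> r y \<longrightarrow> snd (r x) \<le> fst (r y) \<or> snd (r y) \<le> fst (r x)) B"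
      proof (rule pairwiseI)
        fix p q assume "p \<in> B" "q \<in> B" "p \<noteq> q"
        then show "r p \<noteq> r q \<longrightarrow> snd (r p) \<le> fst (r q) \<or> snd (r q) \<le> fst (r p)"
          using pw[of p q] by (auto simp: B_def r_def)
      qed
    qed (use D in \<open>auto simp: B_def r_def\<close>)
    have "var_sum f (l ` A) = (\<Sum>p\<in>D. if fst p < b then \<bar>f (snd (l p)) - f (fst (l p))\<bar> else 0)"
      unfolding var_sum_def A_def using fin injl
      by (subst sum.reindex) (auto simp: A_def sum.inter_filter)
    moreover have "var_sum f (r ` B) = (\<Sum>p\<in>D. if b < snd p then \<bar>f (snd (r p)) - f (fst (r p))\<bar> else 0)"
      unfolding var_sum_def B_def using fin injr
      by (subst sum.reindex) (auto simp: B_def sum.inter_filter)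
    moreover have "var_sum f D \<le> (\<Sum>p\<in>D. (if fst p < b then \<bar>f (snd (l p)) - f (fst (l p))\<bar> else 0)
        + (if b < snd p then \<bar>f (snd (r p)) - f (fst (r p))\<bar> else 0))"
      unfolding var_sum_def
    proof (rule sum_mono)
      fix p assume "p \<in> D"
      then show "\<bar>f (snd p) - f (fst p)\<bar> \<le> (if fst p < b then \<bar>f (snd (l p)) - f (fst (l p))\<bar> else 0)
        + (if b < snd p then \<bar>f (snd (r p)) - f (fst (r p))\<bar> else 0)"
        using D[of p] by (auto simp: l_def r_def min_def max_def)
    qed
    ultimately show "var_sum f D \<le> var_sum f (l ` A) + var_sum f (r ` B)"
      by (simp add: sum.distrib)
  qed
qed

lemma nonoverlapping_insert:
  assumes "nonoverlapping a x D" "a \<le> x" "x < y"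
  shows "nonoverlapping a y (insert (x, y) D)"
    "var_sum f (insert (x, y) D) = var_sum f D + \<bar>f y - f x\<bar>"
proof -
  have "(x, y) \<notin> D" using assms by (auto simp: nonoverlapping_def)
  then show "var_sum f (insert (x, y) D) = var_sum f D + \<bar>f y - f x\<bar>"
    using assms by (simp add: nonoverlapping_def var_sum_def)
  show "nonoverlapping a y (insert (x, y) D)"
    unfolding nonoverlapping_def
  proof (intro conjI ballI)
    have D: "fst p < snd p" "a \<le> fst p" "snd p \<le> x" if "p \<in> D" for p
      using assms(1) that by (auto simp: nonoverlapping_def)
    show "finite (insert (x, y) D)" using assms(1) by (simp add: nonoverlapping_def)
    show "a \<le> fst p" "fst p < snd p" "snd p \<le> y" if "p \<in> insert (x, y) D" for p
      using that D[of p] assms(2,3) by auto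
    show "pairwise (\<lambda>p q. snd p \<le> fst q \<or> snd q \<le> fst p) (insert (x, y) D)"
      using assms(1) D unfolding pairwise_insert by (simp add: nonoverlapping_def)
  qed
qed

lemma nonoverlapping_empty: "nonoverlapping a b {}"
  by (simp add: nonoverlapping_def)

lemma nonoverlapping_mono: "nonoverlapping a b D \<Longrightarrow> a' \<le> a \<Longrightarrow> b \<le> b' \<Longrightarrow> nonoverlapping a' b' D"
  unfolding nonoverlapping_def by (meson order_trans)

section \<open>Bounded variation and absolute continuity of the variation\<close>

text \<open>A family inside an interval shorter than the \<open>\<delta>\<close> that belongs to
  \<epsilon> = 1 contributes less than 1. Cutting into finitely many such intervals bounds every sum
  by the number of pieces.\<close>

lemma ac_pairs_bounded_variation:
  assumes "ac_pairs a b f" "a \<le> x" "x \<le> y" "y \<le> b"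
  shows "bdd_above (var_sum f ` Collect (nonoverlapping x y))"
proof -
  obtain \<delta> where \<delta>: "\<delta> > 0" "\<And>D. nonoverlapping a b D \<Longrightarrow> (\<Sum>p\<in>D. snd p - fst p) < \<delta> \<Longrightarrow> var_sum f D < 1"
    using assms(1) unfolding ac_pairs_def by (meson zero_less_one)
  have *: "var_sum f D \<le> real n" if "nonoverlapping a c D" "a \<le> c" "c \<le> b" "c \<le> a + real n * (\<delta>/2)" for n c D
    using that
  proof (induction n arbitrary: c D)
    case 0
    then have "D = {}" by (fastforce simp: nonoverlapping_def)
    then show ?case by (simp add: var_sum_def)
  next
    case (Suc n)
    \<comment> \<open>Pieces of length at most \<open>\<delta>/2\<close> stay strictly below
      \<open>\<delta>\<close>; the maximum keeps the cut from falling to the left of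
      \<open>a\<close>.\<close>
    define m where "m = max a (c - \<delta>/2)"
    have m: "a \<le> m" "m \<le> c" "m \<le> a + real n * (\<delta>/2)" "c - m < \<delta>"
      using Suc.prems \<delta>(1) by (auto simp: m_def algebra_simps add_divide_distrib max_def)
    obtain D1 D2 where D12: "nonoverlapping a m D1" "nonoverlapping m c D2"
        "var_sum f D \<le> var_sum f D1 + var_sum f D2"
      using nonoverlapping_split[OF Suc.prems(1) m(1,2)] by metis
    have "var_sum f D1 \<le> real n" using Suc.IH[OF D12(1)] m Suc.prems by simp
    moreover have "var_sum f D2 < 1"
      using nonoverlapping_length_le[OF D12(2) m(2)] m nonoverlapping_mono[OF D12(2) m(1) Suc.prems(3)]
      by (intro \<delta>) auto
    ultimately show ?case using D12(3) by simp
  qed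
  obtain n where "(b - a) / (\<delta>/2) \<le> real n" using real_arch_simple by blast
  then have n: "b \<le> a + real n * (\<delta>/2)" using \<delta>(1) by (simp add: field_simps)
  show ?thesis
    using assms * nonoverlapping_mono n by (intro bdd_aboveI[of _ "real n"]) (auto, smt (verit))
qed

text \<open>Appending the interval \<open>(x, y)\<close> to a family on \<open>[a, x]\<close> bounds
  the variation up to \<open>y\<close> from below; cutting a family on \<open>[a, y]\<close> at
  \<open>x\<close> bounds it from above. The lower bound makes both \<open>V\<close> and
  \<open>V - f\<close> nondecreasing on \<open>[a, b]\<close> for
  \<open>V = variation f a\<close>.\<close>

lemma ac_pairs_variation:
  assumes "ac_pairs a b f"
  shows variation_upper: "\<And>x y D. a \<le> x \<Longrightarrow> x \<le> y \<Longrightarrow> y \<le> b \<Longrightarrow> nonoverlapping x y D \<Longrightarrow>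
      var_sum f D \<le> variation f x y"
    and variation_super: "\<And>x y. a \<le> x \<Longrightarrow> x \<le> y \<Longrightarrow> y \<le> b \<Longrightarrow>
      variation f a x + \<bar>f y - f x\<bar> \<le> variation f a y"
    and variation_sub: "\<And>x y. a \<le> x \<Longrightarrow> x \<le> y \<Longrightarrow> y \<le> b \<Longrightarrow>
      variation f a y \<le> variation f a x + variation f x y"
proof -
  show up: "var_sum f D \<le> variation f x y"
    if "a \<le> x" "x \<le> y" "y \<le> b" "nonoverlapping x y D" for x y D
    unfolding variation_def
    using that ac_pairs_bounded_variation[OF assms that(1-3)] by (intro cSup_upper) auto
  show "variation f a x + \<bar>f y - f x\<bar> \<le> variation f a y" if "a \<le> x" "x \<le> y" "y \<le> b" for x y
  proof (cases "x = y")
    case False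
    then have "x < y" using that by simp
    have "variation f a x \<le> variation f a y - \<bar>f y - f x\<bar>"
      unfolding variation_def[of f a x]
    proof (rule cSup_least)
      show "var_sum f ` Collect (nonoverlapping a x) \<noteq> {}" using nonoverlapping_empty by blast
      fix s assume "s \<in> var_sum f ` Collect (nonoverlapping a x)"
      then obtain D where D: "nonoverlapping a x D" "s = var_sum f D" by auto
      have "var_sum f (insert (x,y) D) \<le> variation f a y"
        using that nonoverlapping_insert(1)[OF D(1) that(1) \<open>x < y\<close>] by (intro up) auto
      then show "s \<le> variation f a y - \<bar>f y - f x\<bar>"
        using nonoverlapping_insert(2)[OF D(1) that(1) \<open>x < y\<close>, of f] D by simp
    qed
    then show ?thesis by simp
  qed simp
  show "variation f a y \<le> variation f a x + variation f x y" if "a \<le> x" "x \<le> y" "y \<le> b" for x y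
    unfolding variation_def[of f a y]
  proof (rule cSup_least)
    note xy = that
    show "var_sum f ` Collect (nonoverlapping a y) \<noteq> {}" using nonoverlapping_empty by blast
    fix s assume "s \<in> var_sum f ` Collect (nonoverlapping a y)"
    then obtain D where D: "nonoverlapping a y D" "s = var_sum f D" by auto
    obtain D1 D2 where "nonoverlapping a x D1" "nonoverlapping x y D2"
        "var_sum f D \<le> var_sum f D1 + var_sum f D2"
      using nonoverlapping_split[OF D(1) xy(1,2)] by metis
    then show "s \<le> variation f a x + variation f x y"
      using up[of a x D1] up[of x y D2] xy D by auto
  qed
qed

text \<open>Subfamilies inside different members of \<open>D\<close> inherit the separation of those
  members, which also keeps any pair from being counted twice.\<close>

lemma nonoverlapping_UN:
  assumes D: "nonoverlapping a b D" and E: "\<And>p. p \<in> D \<Longrightarrow> nonoverlapping (fst p) (snd p) (E p)"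
  shows "nonoverlapping a b (\<Union>p\<in>D. E p)"
    and "(\<Sum>q\<in>(\<Union>p\<in>D. E p). h q) = (\<Sum>p\<in>D. \<Sum>q\<in>E p. (h q :: real))"
proof -
  have cross: "snd q \<le> fst q' \<or> snd q' \<le> fst q"
    if "p \<in> D" "p' \<in> D" "p \<noteq> p'" "q \<in> E p" "q' \<in> E p'" for p p' q q'
  proof -
    have "snd p \<le> fst p' \<or> snd p' \<le> fst p"
      using D that by (auto simp: nonoverlapping_def pairwise_def)
    moreover have "fst p \<le> fst q" "snd q \<le> snd p" "fst p' \<le> fst q'" "snd q' \<le> snd p'"
      using E[OF that(1)] E[OF that(2)] that by (auto simp: nonoverlapping_def)
    ultimately show ?thesis by linarith
  qed
  have lt: "fst q < snd q \<and> a \<le> fst q \<and> snd q \<le> b" if "p \<in> D" "q \<in> E p" for p q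
    using E[OF that(1)] that D by (force simp: nonoverlapping_def)
  show "nonoverlapping a b (\<Union>p\<in>D. E p)"
    unfolding nonoverlapping_def
  proof (intro conjI ballI)
    show "finite (\<Union>p\<in>D. E p)" using D E by (auto simp: nonoverlapping_def)
    show "pairwise (\<lambda>p q. snd p \<le> fst q \<or> snd q \<le> fst p) (\<Union>p\<in>D. E p)"
    proof (rule pairwiseI)
      fix q q' assume "q \<in> (\<Union>p\<in>D. E p)" "q' \<in> (\<Union>p\<in>D. E p)" "q \<noteq> q'"
      then obtain p p' where p: "p \<in> D" "q \<in> E p" "p' \<in> D" "q' \<in> E p'" by auto
      show "snd q \<le> fst q' \<or> snd q' \<le> fst q"
      proof (cases "p = p'")
        case True
        then show ?thesis using E[OF p(1)] p \<open>q \<noteq> q'\<close> by (auto simp: nonoverlapping_def pairwise_def)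
      qed (use cross p in blast)
    qed
  qed (use lt in auto)
  show "(\<Sum>q\<in>(\<Union>p\<in>D. E p). h q) = (\<Sum>p\<in>D. \<Sum>q\<in>E p. h q)"
  proof (rule sum.UNION_disjoint)
    \<comment> \<open>A pair lying in both families would have to precede itself, against
      \<open>fst q < snd q\<close>.\<close>
    show "\<forall>p\<in>D. \<forall>p'\<in>D. p \<noteq> p' \<longrightarrow> E p \<inter> E p' = {}"
      using cross lt by (meson disjoint_iff not_le)
  qed (use D E in \<open>auto simp: nonoverlapping_def\<close>)
qed

text \<open>Each increment of the variation is nearly attained by a family inside the same interval.
  The union of these families is no longer than \<open>D\<close>, so the smallness of the sums of
  \<open>f\<close> carries over.\<close>

lemma ac_pairs_variation_ac:
  assumes "ac_pairs a b f"
  shows "ac_pairs a b (variation f a)"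
  unfolding ac_pairs_def
proof (intro allI impI)
  fix \<epsilon> :: real assume "\<epsilon> > 0"
  then obtain \<delta> where \<delta>: "\<delta> > 0"
    "\<And>D. nonoverlapping a b D \<Longrightarrow> (\<Sum>p\<in>D. snd p - fst p) < \<delta> \<Longrightarrow> var_sum f D < \<epsilon>/2"
    using assms unfolding ac_pairs_def by (meson half_gt_zero)
  show "\<exists>\<delta>>0. \<forall>D. nonoverlapping a b D \<and> (\<Sum>p\<in>D. snd p - fst p) < \<delta> \<longrightarrow> var_sum (variation f a) D < \<epsilon>"
  proof (intro exI conjI allI impI)
    fix D assume D: "nonoverlapping a b D \<and> (\<Sum>p\<in>D. snd p - fst p) < \<delta>"
    then have Dp: "a \<le> fst p" "fst p \<le> snd p" "snd p \<le> b" if "p \<in> D" for p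
      using that by (auto simp: nonoverlapping_def)
    \<comment> \<open>The approximation errors add up to at most \<open>\<epsilon> / 2\<close>; the
      \<open>+ 1\<close> keeps the denominator positive for empty \<open>D\<close>.\<close>
    define \<eta> where "\<eta> = \<epsilon> / (2 * (real (card D) + 1))"
    have \<eta>: "\<eta> > 0" using \<open>\<epsilon> > 0\<close> by (auto simp: \<eta>_def intro!: divide_pos_pos)
    have "real (card D) * \<eta> \<le> \<epsilon> / 2"
      using \<open>\<epsilon> > 0\<close> by (simp add: \<eta>_def field_simps)
    have "\<exists>E. nonoverlapping (fst p) (snd p) E \<and> variation f (fst p) (snd p) - \<eta> < var_sum f E"
      if "p \<in> D" for p
    proof -
      have "variation f (fst p) (snd p) - \<eta> < Sup (var_sum f ` Collect (nonoverlapping (fst p) (snd p)))"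
        using \<eta> by (simp add: variation_def)
      then show ?thesis
        using ac_pairs_bounded_variation[OF assms Dp[OF that]] nonoverlapping_empty
        by (subst (asm) less_cSup_iff) auto
    qed
    then obtain E where E: "\<And>p. p \<in> D \<Longrightarrow> nonoverlapping (fst p) (snd p) (E p)"
      "\<And>p. p \<in> D \<Longrightarrow> variation f (fst p) (snd p) - \<eta> < var_sum f (E p)" by metis
    have U: "nonoverlapping a b (\<Union>p\<in>D. E p)"
      "(\<Sum>q\<in>(\<Union>p\<in>D. E p). h q) = (\<Sum>p\<in>D. \<Sum>q\<in>E p. h q)" for h :: "_ \<Rightarrow> real"
      by (rule nonoverlapping_UN[OF conjunct1[OF D]]; rule E; assumption)+
    have "(\<Sum>q\<in>(\<Union>p\<in>D. E p). snd q - fst q) \<le> (\<Sum>p\<in>D. snd p - fst p)"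
      unfolding U(2) using nonoverlapping_length_le[OF E(1)] Dp by (intro sum_mono) auto
    then have "var_sum f (\<Union>p\<in>D. E p) < \<epsilon>/2"
      using D by (intro \<delta> U(1)) auto
    moreover have "var_sum f (\<Union>p\<in>D. E p) = (\<Sum>p\<in>D. var_sum f (E p))"
      unfolding var_sum_def by (rule U(2))
    moreover have "var_sum (variation f a) D \<le> (\<Sum>p\<in>D. var_sum f (E p) + \<eta>)"
      unfolding var_sum_def[of "variation f a"]
    proof (rule sum_mono)
      fix p assume p: "p \<in> D"
      show "\<bar>variation f a (snd p) - variation f a (fst p)\<bar> \<le> var_sum f (E p) + \<eta>"
        using E(2)[OF p] variation_super[OF assms Dp[OF p]] variation_sub[OF assms Dp[OF p]] by linarith
    qed
    ultimately show "var_sum (variation f a) D < \<epsilon>"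
      using \<open>real (card D) * \<eta> \<le> \<epsilon> / 2\<close> by (simp add: sum.distrib)
  qed (use \<delta> in auto)
qed

lemma ac_pairs_diff:
  assumes "ac_pairs a b f" "ac_pairs a b g"
  shows "ac_pairs a b (\<lambda>x. f x - g x)"
  unfolding ac_pairs_def
proof (intro allI impI)
  fix \<epsilon> :: real assume "\<epsilon> > 0"
  then have "\<epsilon>/2 > 0" by simp
  obtain \<delta> where \<delta>: "\<delta> > 0"
    "\<And>D. nonoverlapping a b D \<Longrightarrow> (\<Sum>p\<in>D. snd p - fst p) < \<delta> \<Longrightarrow> var_sum f D < \<epsilon>/2"
    using assms(1) \<open>\<epsilon>/2 > 0\<close> unfolding ac_pairs_def by meson
  obtain \<gamma> where \<gamma>: "\<gamma> > 0"
    "\<And>D. nonoverlapping a b D \<Longrightarrow> (\<Sum>p\<in>D. snd p - fst p) < \<gamma> \<Longrightarrow> var_sum g D < \<epsilon>/2"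
    using assms(2) \<open>\<epsilon>/2 > 0\<close> unfolding ac_pairs_def by meson
  have "var_sum (\<lambda>x. f x - g x) D \<le> var_sum f D + var_sum g D" for D
    unfolding var_sum_def sum.distrib[symmetric] by (intro sum_mono) linarith
  then show "\<exists>\<delta>>0. \<forall>D. nonoverlapping a b D \<and> (\<Sum>p\<in>D. snd p - fst p) < \<delta> \<longrightarrow> var_sum (\<lambda>x. f x - g x) D < \<epsilon>"
    using \<delta> \<gamma> by (intro exI[of _ "min \<delta> \<gamma>"]) (auto, smt (verit, best) field_sum_of_halves)
qed

lemma ac_pairs_continuous:
  assumes "ac_pairs a b f"
  shows "continuous_on {a..b} f"
  unfolding continuous_on_iff
proof (intro ballI allI impI)
  fix x \<epsilon> :: real assume x: "x \<in> {a..b}" and "\<epsilon> > 0"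
  then obtain \<delta> where \<delta>: "\<delta> > 0"
    "\<And>D. nonoverlapping a b D \<Longrightarrow> (\<Sum>p\<in>D. snd p - fst p) < \<delta> \<Longrightarrow> var_sum f D < \<epsilon>"
    using assms unfolding ac_pairs_def by meson
  have *: "\<bar>f d - f c\<bar> < \<epsilon>" if "a \<le> c" "c < d" "d \<le> b" "d - c < \<delta>" for c d
    using \<delta>(2)[of "{(c,d)}"] that by (simp add: nonoverlapping_def var_sum_def)
  have "dist (f y) (f x) < \<epsilon>" if "y \<in> {a..b}" "dist y x < \<delta>" for y
    using *[of x y] *[of y x] x that \<open>\<epsilon> > 0\<close> by (cases x y rule: linorder_cases) (auto simp: dist_real_def)
  with \<delta>(1) show "\<exists>d>0. \<forall>y\<in>{a..b}. dist y x < d \<longrightarrow> dist (f y) (f x) < \<epsilon>" by blast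
qed

text \<open>Nondegeneracy makes the passage from pairs to compact intervals injective, so it turns a
  family into a division with the same sums.\<close>

lemma absolutely_continuous_imp_ac_pairs:
  assumes "absolutely_continuous_on {a..b} f"
  shows "ac_pairs a b f"
  unfolding ac_pairs_def
proof (intro allI impI)
  fix \<epsilon> :: real assume "\<epsilon> > 0"
  then obtain \<delta> where \<delta>: "\<delta> > 0"
    "\<And>D T. D division_of T \<Longrightarrow> T \<subseteq> {a..b} \<Longrightarrow> (\<Sum>K\<in>D. Sup K - Inf K) < \<delta> \<Longrightarrow>
        (\<Sum>K\<in>D. \<bar>f (Sup K) - f (Inf K)\<bar>) < \<epsilon>"
    using assms unfolding absolutely_continuous_on_def by meson
  show "\<exists>\<delta>>0. \<forall>D. nonoverlapping a b D \<and> (\<Sum>p\<in>D. snd p - fst p) < \<delta> \<longrightarrow> var_sum f D < \<epsilon>"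
  proof (intro exI conjI allI impI)
    fix D assume D: "nonoverlapping a b D \<and> (\<Sum>p\<in>D. snd p - fst p) < \<delta>"
    define I where "I p = {fst p..snd p}" for p :: "real \<times> real"
    have Dp: "a \<le> fst p" "fst p < snd p" "snd p \<le> b" if "p \<in> D" for p
      using D that by (auto simp: nonoverlapping_def)
    have inj: "inj_on I D"
      by (rule inj_onI) (use Dp in \<open>force simp: I_def prod_eq_iff\<close>)
    have eqs: "Sup (I p) = snd p" "Inf (I p) = fst p" if "p \<in> D" for p
      using Dp[OF that] by (auto simp: I_def)
    have "(I ` D) division_of \<Union>(I ` D)"
    proof (rule division_ofI)
      fix K1 K2 assume "K1 \<in> I ` D" "K2 \<in> I ` D" "K1 \<noteq> K2"
      then obtain p q where "p \<in> D" "q \<in> D" "p \<noteq> q" "K1 = I p" "K2 = I q" by blast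
      moreover from this have "snd p \<le> fst q \<or> snd q \<le> fst p"
        using D by (auto simp: nonoverlapping_def pairwise_def)
      ultimately show "interior K1 \<inter> interior K2 = {}"
        by (auto simp: I_def interior_atLeastAtMost_real)
    next
      fix K assume "K \<in> I ` D"
      then obtain p where p: "p \<in> D" "K = I p" by blast
      show "K \<noteq> {}" using p Dp[OF p(1)] by (simp add: I_def)
      show "\<exists>c d. K = cbox c d" using p by (auto simp: I_def)
    qed (use D in \<open>auto simp: nonoverlapping_def\<close>)
    moreover have "\<Union>(I ` D) \<subseteq> {a..b}" using Dp by (force simp: I_def)
    moreover have "(\<Sum>K\<in>I ` D. Sup K - Inf K) = (\<Sum>p\<in>D. snd p - fst p)"
      by (simp add: sum.reindex[OF inj] eqs cong: sum.cong)
    moreover have "(\<Sum>K\<in>I ` D. \<bar>f (Sup K) - f (Inf K)\<bar>) = var_sum f D"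
      unfolding var_sum_def by (simp add: sum.reindex[OF inj] eqs cong: sum.cong)
    ultimately show "var_sum f D < \<epsilon>" using \<delta>(2) D by metis
  qed (use \<delta> in auto)
qed

subsection \<open>The fundamental theorem of calculus\<close>

text \<open>Enclose \<open>X\<close> in an open \<open>U\<close> of measure below
  \<open>\<delta>\<close> and cover \<open>X \<inter> {a..b}\<close> by countably many compact
  intervals inside \<open>U\<close> with disjoint interiors. Finite subfamilies have length below
  \<open>\<delta>\<close>, so absolute continuity bounds their Stieltjes measure by
  \<open>\<epsilon>\<close>.\<close>

lemma ac_pairs_interval_measure_null:
  assumes ac: "ac_pairs a b F" and "a < b" and mono: "mono F" and cont: "continuous_on UNIV F"
    and X: "X \<in> null_sets lborel"
  shows "emeasure (interval_measure F) (X \<inter> {a..b}) = 0"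
proof -
  let ?M = "interval_measure F"
  have [measurable]: "X \<in> sets borel" using X by auto
  have "emeasure ?M (X \<inter> {a..b}) \<le> 0 + ennreal \<epsilon>" if "\<epsilon> > 0" for \<epsilon>
  proof -
    obtain \<delta> where \<delta>: "\<delta> > 0"
      "\<And>D. nonoverlapping a b D \<Longrightarrow> (\<Sum>p\<in>D. snd p - fst p) < \<delta> \<Longrightarrow> var_sum F D < \<epsilon>"
      using ac \<open>\<epsilon> > 0\<close> unfolding ac_pairs_def by meson
    obtain U where U: "open U" "X \<subseteq> U" "emeasure lborel (U - X) < ennreal \<delta>"
      using outer_regular_lborel[of X \<delta>] \<delta>(1) X by auto
    have "emeasure lborel U < ennreal \<delta>"
      using U(3) emeasure_Diff_null_set[OF X, of U] U(1) by simp
    then have "emeasure lborel U < \<infinity>" by (rule order_less_trans) simp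
    then have Ufin: "U \<in> fmeasurable lborel" using U(1) by (simp add: fmeasurable_def)
    have Um: "measure lborel U < \<delta>"
      using \<open>emeasure lborel U < ennreal \<delta>\<close> \<open>emeasure lborel U < \<infinity>\<close> \<delta>(1)
      by (subst (asm) emeasure_eq_ennreal_measure) (auto simp: ennreal_less_iff)
    obtain \<D> where \<D>: "countable \<D>" "\<Union>\<D> \<subseteq> cbox a b"
      "\<And>K. K \<in> \<D> \<Longrightarrow> interior K \<noteq> {} \<and> (\<exists>c d. K = cbox c d)"
      "pairwise (\<lambda>A B. interior A \<inter> interior B = {}) \<D>"
      "\<And>K. K \<in> \<D> \<Longrightarrow> \<exists>x\<in>(X \<inter> {a..b}) \<inter> K. K \<subseteq> (if x \<in> U then U else UNIV)"
      "X \<inter> {a..b} \<subseteq> \<Union>\<D>"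
    \<comment> \<open>At points of \<open>X\<close> the gauge is \<open>U\<close>, and each covering
      interval is tagged by a point of \<open>X\<close>, so all of them lie in \<open>U\<close>.
      Outside \<open>U\<close> the value \<open>UNIV\<close> makes the function a gauge on the whole
      line.\<close>
    proof (rule covering_lemma[of "X \<inter> {a..b}" a b "\<lambda>x. if x \<in> U then U else UNIV"])
      show "gauge (\<lambda>x. if x \<in> U then U else UNIV)"
        using U(1) by (auto simp: gauge_def)
    qed (use \<open>a < b\<close> in auto)
    have K: "Inf K < Sup K" "K = {Inf K..Sup K}" "a \<le> Inf K" "Sup K \<le> b" "K \<subseteq> U" if K: "K \<in> \<D>" for K
    proof -
      obtain c d where cd: "K = {c..d}" "c < d"
        using \<D>(3)[OF K] by (force simp: interior_atLeastAtMost_real)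
      then have "Inf K = c" "Sup K = d" by auto
      moreover have "K \<subseteq> {a..b}" using \<D>(2) K by auto
      ultimately show "Inf K < Sup K" "K = {Inf K..Sup K}" "a \<le> Inf K" "Sup K \<le> b" using cd by auto
      show "K \<subseteq> U" using \<D>(5)[OF K] U(2) by (auto split: if_splits)
    qed
    have Kb: "K \<in> sets borel" if "K \<in> \<D>" for K
      by (subst K(2)[OF that]) simp
    have fin: "emeasure ?M (\<Union>E) \<le> ennreal \<epsilon>" if E: "finite E" "E \<subseteq> \<D>" for E
    proof -
      define i where "i K = (Inf K, Sup K)" for K :: "real set"
      have inj: "inj_on i E"
        by (rule inj_onI) (metis K(2) E(2) i_def prod.inject subsetD)
      have no: "nonoverlapping a b (i ` E)"
        unfolding nonoverlapping_def
      proof (intro conjI ballI)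
        show "pairwise (\<lambda>p q. snd p \<le> fst q \<or> snd q \<le> fst p) (i ` E)"
        proof (rule pairwiseI, clarsimp simp: i_def)
          fix A B assume AB: "A \<in> E" "B \<in> E" "Inf A = Inf B \<longrightarrow> Sup A \<noteq> Sup B" "\<not> Sup B \<le> Inf A"
          then have "A \<noteq> B" by auto
          with AB have "interior A \<inter> interior B = {}" using \<D>(4) E(2) by (auto simp: pairwise_def)
          moreover have "interior A = {Inf A<..<Sup A}" "interior B = {Inf B<..<Sup B}"
            using K(2)[of A] K(2)[of B] AB E(2) by (metis interior_atLeastAtMost_real subsetD)+
          ultimately have "{Inf A<..<Sup A} \<inter> {Inf B<..<Sup B} = {}" by simp
          \<comment> \<open>Two open intervals meet in the open interval from the larger left to the
            smaller right endpoint.\<close>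
          then have "{max (Inf A) (Inf B)<..<min (Sup A) (Sup B)} = {}" by auto
          then have "min (Sup A) (Sup B) \<le> max (Inf A) (Inf B)" by simp
          then show "Sup A \<le> Inf B"
            using AB(4) K(1)[of A] K(1)[of B] AB(1,2) E(2) by (auto simp: min_def max_def split: if_splits)
        qed
      qed (use E K in \<open>auto simp: i_def\<close>)
      have "measure lborel (\<Union>p\<in>i ` E. {fst p<..<snd p}) \<le> measure lborel U"
      proof (rule measure_mono_fmeasurable[OF _ _ Ufin])
        show "(\<Union>p\<in>i ` E. {fst p<..<snd p}) \<in> sets lborel" by (simp add: borel_open open_UN)
        show "(\<Union>p\<in>i ` E. {fst p<..<snd p}) \<subseteq> U"
        proof
          fix x assume "x \<in> (\<Union>p\<in>i ` E. {fst p<..<snd p})"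
          then obtain A where A: "A \<in> E" "Inf A < x" "x < Sup A" by (auto simp: i_def)
          then have "x \<in> {Inf A..Sup A}" by simp
          then show "x \<in> U" using K(2,5)[of A] A(1) E(2) by blast
        qed
      qed
      then have "var_sum F (i ` E) < \<epsilon>"
        using Um by (intro \<delta>(2) no) (simp add: nonoverlapping_length_eq[OF no])
      have "emeasure ?M (\<Union>E) \<le> (\<Sum>A\<in>E. emeasure ?M A)"
        using emeasure_subadditive_finite[of E "\<lambda>x. x" ?M] E Kb by auto
      also have "\<dots> = (\<Sum>A\<in>E. ennreal (F (Sup A) - F (Inf A)))"
      proof (rule sum.cong[OF refl])
        fix A assume "A \<in> E"
        then have A: "A \<in> \<D>" using E by auto
        \<comment> \<open>Continuity rules out atoms, so closed intervals too have the increment of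
          \<open>F\<close> as measure.\<close>
        show "emeasure ?M A = ennreal (F (Sup A) - F (Inf A))"
          using emeasure_interval_measure_Icc[of "Inf A" "Sup A" F] K(1,2)[OF A] mono cont
          by (auto simp: mono_def)
      qed
      also have "\<dots> = ennreal (\<Sum>A\<in>E. F (Sup A) - F (Inf A))"
        using E K(1) mono by (intro sum_ennreal) (auto simp: mono_def less_imp_le)
      also have "(\<Sum>A\<in>E. F (Sup A) - F (Inf A)) = var_sum F (i ` E)"
        unfolding var_sum_def sum.reindex[OF inj]
        using E K(1) mono by (intro sum.cong) (auto simp: i_def mono_def less_imp_le subset_iff)
      also have "ennreal \<dots> \<le> ennreal \<epsilon>" using \<open>var_sum F (i ` E) < \<epsilon>\<close> by (intro ennreal_leI) simp
      finally show ?thesis .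
    qed
    have "emeasure ?M (\<Union>\<D>) \<le> ennreal \<epsilon>"
    proof (cases "\<D> = {}")
      case False
      \<comment> \<open>Finite unions along an enumeration increase to the whole cover, and
        continuity from below carries the bound for finite subfamilies to the countable
        union.\<close>
      define C where "C n = (\<Union>k\<le>n. from_nat_into \<D> k)" for n :: nat
      have in\<D>: "from_nat_into \<D> k \<in> \<D>" for k using False by (rule from_nat_into)
      have "\<Union>\<D> = (\<Union>n. C n)"
        unfolding C_def by (subst range_from_nat_into[OF False \<D>(1), symmetric]) blast
      moreover have "(SUP n. emeasure ?M (C n)) = emeasure ?M (\<Union>n. C n)"
      proof (rule SUP_emeasure_incseq)
        have "from_nat_into \<D> k \<in> sets borel" for k
          by (rule Kb[OF in\<D>])
        then show "range C \<subseteq> sets ?M" by (auto simp: C_def)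
        show "incseq C" unfolding incseq_def C_def by (intro allI impI UN_mono) auto
      qed
      moreover have "(SUP n. emeasure ?M (C n)) \<le> ennreal \<epsilon>"
        unfolding C_def using in\<D> by (intro SUP_least fin) auto
      ultimately show ?thesis by simp
    qed simp
    moreover have "\<Union>\<D> \<in> sets ?M"
      using \<D>(1) Kb by (intro sets.countable_Union) auto
    ultimately show ?thesis
      using emeasure_mono[OF \<D>(6), of ?M] by (auto intro: order_trans)
  qed
  then have "emeasure ?M (X \<inter> {a..b}) \<le> 0"
    by (rule ennreal_le_epsilon)
  then show ?thesis by simp
qed

text \<open>The Stieltjes measure of \<open>F\<close>, restricted to \<open>[a, b]\<close>, is
  absolutely continuous with respect to Lebesgue measure, and its Radon-Nikodym density integrates
  back to the increments of \<open>F\<close>.\<close>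

lemma ac_pairs_mono_density:
  assumes ac: "ac_pairs a b F" and "a < b" and mono: "mono_on {a..b} F"
  obtains f :: "real \<Rightarrow> real" where "\<And>x. 0 \<le> f x"
    "\<And>x. x \<in> {a..b} \<Longrightarrow> (f has_integral (F x - F a)) {a..x}"
proof -
  \<comment> \<open>Continuing \<open>F\<close> by its endpoint values makes it nondecreasing and
    continuous on the whole line, where the Stieltjes measure lives.\<close>
  define G where "G x = F (max a (min b x))" for x
  have GF: "G x = F x" if "x \<in> {a..b}" for x using that by (auto simp: G_def min_def max_def)
  have mG: "mono G"
    using mono \<open>a < b\<close> by (auto intro!: monoI simp: G_def mono_on_def)
  have cG: "continuous_on UNIV G"
    unfolding G_def
    by (rule continuous_on_compose2[OF ac_pairs_continuous[OF ac]])
      (use \<open>a < b\<close> in \<open>auto intro!: continuous_intros\<close>)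
  have acG: "ac_pairs a b G"
  proof -
    have "var_sum G D = var_sum F D" if "nonoverlapping a b D" for D
      unfolding var_sum_def using that by (intro sum.cong) (auto simp: nonoverlapping_def GF)
    then show ?thesis using ac by (simp add: ac_pairs_def cong: conj_cong)
  qed
  let ?M = "interval_measure G"
  define R where "R = density ?M (indicator {a..b})"
  have R: "emeasure R X = emeasure ?M (X \<inter> {a..b})" if "X \<in> sets borel" for X
    using that by (simp add: R_def emeasure_density nn_integral_indicator Int_commute
        flip: indicator_inter_arith)
  have "absolutely_continuous lborel R"
    unfolding absolutely_continuous_def
  proof
    fix X :: "real set" assume X: "X \<in> null_sets lborel"
    then have "X \<in> sets borel" by auto
    then show "X \<in> null_sets R"
      using R[of X] ac_pairs_interval_measure_null[OF acG \<open>a < b\<close> mG cG X]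
      by (simp add: null_sets_def R_def)
  qed
  moreover have "sets R = sets lborel" by (simp add: R_def)
  ultimately obtain h where h: "h \<in> borel_measurable lborel" "density lborel h = R"
    using sigma_finite_measure.Radon_Nikodym[OF sigma_finite_lborel] by blast
  have [measurable]: "h \<in> borel_measurable borel" using h(1) by simp
  have hint: "(\<integral>\<^sup>+y. h y * indicator {a..x} y \<partial>lborel) = ennreal (F x - F a)" if x: "x \<in> {a..b}" for x
  proof -
    have "(\<integral>\<^sup>+y. h y * indicator {a..x} y \<partial>lborel) = emeasure R {a..x}"
      using h by (simp add: h(2)[symmetric] emeasure_density)
    also have "\<dots> = emeasure ?M {a..x}" using x by (simp add: R Int_absorb2)
    also have "\<dots> = ennreal (G x - G a)"
      using emeasure_interval_measure_Icc[of a x G] x mG cG by (auto simp: mono_def)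
    finally show ?thesis using x by (simp add: GF)
  qed
  \<comment> \<open>A finite integral forces the extended-valued density to be finite almost
    everywhere, so passing to \<open>enn2real (h y)\<close> leaves the integrals unchanged.\<close>
  have "AE y in lborel. h y * indicator {a..b} y \<noteq> \<infinity>"
    using hint[of b] \<open>a < b\<close> by (intro nn_integral_PInf_AE) auto
  then have fin: "AE y in lborel. y \<in> {a..b} \<longrightarrow> h y \<noteq> \<infinity>"
    by (rule AE_mp) (auto simp: indicator_def)
  show thesis
  proof (rule that)
    show "0 \<le> enn2real (h x)" for x by simp
    fix x assume x: "x \<in> {a..b}"
    have "(\<integral>\<^sup>+y. ennreal (enn2real (h y) * indicator {a..x} y) \<partial>lborel) =
        (\<integral>\<^sup>+y. h y * indicator {a..x} y \<partial>lborel)"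
      by (rule nn_integral_cong_AE, rule AE_mp[OF fin])
        (use x in \<open>auto simp: indicator_def less_top intro!: AE_I2\<close>)
    then have "((\<lambda>y. enn2real (h y) * indicator {a..x} y) has_integral (F x - F a)) UNIV"
      using x mono \<open>a < b\<close> hint[OF x]
      by (intro nn_integral_has_integral) (auto simp: mono_on_def)
    moreover have "(\<lambda>y. enn2real (h y) * indicator {a..x} y) = (\<lambda>y. if y \<in> {a..x} then enn2real (h y) else 0)"
      by (auto simp: indicator_def)
    ultimately show "((\<lambda>x. enn2real (h x)) has_integral (F x - F a)) {a..x}"
      by (metis has_integral_restrict_UNIV)
  qed
qed

section \<open>Lebesgue differentiation of an indefinite integral\<close>

text \<open>Almost everywhere the averages of \<open>h\<close> over \<open>[x, x + k]\<close> with
  \<open>k > 0\<close> converge to \<open>h x\<close>, which gives the right derivative. The same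
  fact for \<open>h (- y)\<close> at \<open>- x\<close> gives the left one.\<close>

lemma integral_has_real_derivative_ae:
  fixes g :: "real \<Rightarrow> real"
  assumes "g integrable_on {a..b}"
  obtains N where "negligible N"
    "\<And>x. x \<in> {a<..<b} - N \<Longrightarrow> ((\<lambda>y. integral {a..y} g) has_real_derivative g x) (at x)"
proof -
  \<comment> \<open>Extension by zero makes the function integrable over every interval, as the
    differentiation result for the whole line demands.\<close>
  define h where "h y = (if y \<in> {a..b} then g y else 0)" for y
  have "h integrable_on UNIV" using assms unfolding h_def[abs_def] by (simp only: integrable_restrict_UNIV)
  then have h: "h integrable_on cbox c d" for c d by (rule integrable_on_subcbox) simp
  have h': "(\<lambda>y. h (- y)) integrable_on cbox c d" for c d :: real
    using h[of "-d" "-c"] Henstock_Kurzweil_Integration.integrable_reflect_real[of h "-c" "-d"] by simp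
  obtain N1 where N1: "negligible N1"
    "\<And>x e. x \<notin> N1 \<Longrightarrow> 0 < e \<Longrightarrow> \<exists>d>0. \<forall>k. 0 < k \<and> k < d \<longrightarrow>
       norm (integral (cbox x (x + k *\<^sub>R One)) h /\<^sub>R k ^ DIM(real) - h x) < e"
    using integrable_ccontinuous_explicit[of h] h by metis
  obtain N2 where N2: "negligible N2"
    "\<And>x e. x \<notin> N2 \<Longrightarrow> 0 < e \<Longrightarrow> \<exists>d>0. \<forall>k. 0 < k \<and> k < d \<longrightarrow>
       norm (integral (cbox x (x + k *\<^sub>R One)) (\<lambda>y. h (- y)) /\<^sub>R k ^ DIM(real) - h (- x)) < e"
    using integrable_ccontinuous_explicit[of "\<lambda>y. h (- y)"] h' by metis
  show thesis
  proof (rule that)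
    \<comment> \<open>Reflection is differentiable, so it maps negligible sets to negligible
      sets.\<close>
    show "negligible (N1 \<union> uminus ` N2)"
      using N1(1) N2(1)
      by (intro negligible_Un negligible_differentiable_image_negligible derivative_intros order_refl)
    fix x assume x: "x \<in> {a<..<b} - (N1 \<union> uminus ` N2)"
    then have xN: "x \<notin> N1" "- x \<notin> N2" by (auto simp: image_iff)
    have xab: "a < x" "x < b" "h x = g x" using x by (auto simp: h_def)
    have sub: "integral {a..d} g - integral {a..c} g = integral {c..d} h" if "a \<le> c" "c \<le> d" "d \<le> b" for c d
    proof -
      have "g integrable_on {a..d}" using assms that by (meson atLeastatMost_subset_iff integrable_on_subinterval order_refl)
      then have "integral {a..c} g + integral {c..d} g = integral {a..d} g"
        using that by (intro Henstock_Kurzweil_Integration.integral_combine)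
      moreover have "integral {c..d} g = integral {c..d} h"
        using that by (intro integral_cong) (simp add: h_def)
      ultimately show ?thesis by simp
    qed
    show "((\<lambda>y. integral {a..y} g) has_real_derivative g x) (at x)"
      unfolding DERIV_def LIM_eq
    proof (intro allI impI)
      fix e :: real assume "e > 0"
      obtain d1 where d1: "d1 > 0" "\<And>k. 0 < k \<Longrightarrow> k < d1 \<Longrightarrow> \<bar>integral {x..x + k} h / k - g x\<bar> < e"
        using N1(2)[OF xN(1) \<open>e > 0\<close>] xab by (auto simp: divide_inverse mult.commute)
      obtain d2 where d2: "d2 > 0" "\<And>k. 0 < k \<Longrightarrow> k < d2 \<Longrightarrow> \<bar>integral {-x..-x + k} (\<lambda>y. h (- y)) / k - g x\<bar> < e"
        using N2(2)[OF xN(2) \<open>e > 0\<close>] xab by (auto simp: divide_inverse mult.commute)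
      have "\<bar>(integral {a..x + k} g - integral {a..x} g) / k - g x\<bar> < e"
        if k: "k \<noteq> 0" "\<bar>k\<bar> < min (min d1 d2) (min (x - a) (b - x))" for k
      proof (cases "k > 0")
        case True
        then show ?thesis using sub[of x "x + k"] d1(2)[of k] k xab by simp
      next
        case False
        have "integral {-x..-x + (- k)} (\<lambda>y. h (- y)) = integral {x + k..x} h"
          using Henstock_Kurzweil_Integration.integral_reflect_real[of x "x + k" h] by simp
        moreover have "integral {a..x + k} g - integral {a..x} g = - integral {x + k..x} h"
          using sub[of "x + k" x] False k xab by simp
        ultimately show ?thesis using d2(2)[of "- k"] False k by simp
      qed
      then show "\<exists>s>0. \<forall>k. k \<noteq> 0 \<and> norm (k - 0) < s \<longrightarrow>
          norm ((integral {a..x + k} g - integral {a..x} g) / k - g x) < e"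
        using d1(1) d2(1) xab by (intro exI[of _ "min (min d1 d2) (min (x - a) (b - x))"]) simp
    qed
  qed
qed

section \<open>Absolutely continuous functions as integrals of their derivatives\<close>

text \<open>With \<open>V\<close> the variation, \<open>w = V - (V - w)\<close> is a difference of
  nondecreasing absolutely continuous functions. The difference of their densities is a density of
  \<open>w\<close> and equals its derivative almost everywhere.\<close>

lemma absolutely_continuous_on_density:
  fixes w :: "real \<Rightarrow> real"
  assumes "absolutely_continuous_on {a..b} w" "a < b"
  obtains g N where "g absolutely_integrable_on {a..b}"
    "\<And>x. x \<in> {a..b} \<Longrightarrow> (g has_integral (w x - w a)) {a..x}"
    "negligible N" "\<And>x. x \<in> {a..b} - N \<Longrightarrow> (w has_real_derivative g x) (at x within {a..b})"
proof -
  note ac = absolutely_continuous_imp_ac_pairs[OF assms(1)]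
  define V where "V = variation w a"
  have acV: "ac_pairs a b V" unfolding V_def by (rule ac_pairs_variation_ac[OF ac])
  have inc: "V x + \<bar>w y - w x\<bar> \<le> V y" if "a \<le> x" "x \<le> y" "y \<le> b" for x y
    unfolding V_def using variation_super[OF ac that] .
  have "mono_on {a..b} V" using inc by (fastforce simp: mono_on_def)
  then obtain f1 where f1: "\<And>x. 0 \<le> f1 x" "\<And>x. x \<in> {a..b} \<Longrightarrow> (f1 has_integral (V x - V a)) {a..x}"
    using ac_pairs_mono_density[OF acV assms(2)] by blast
  have "mono_on {a..b} (\<lambda>x. V x - w x)" using inc by (fastforce simp: mono_on_def)
  then obtain f2 where f2: "\<And>x. 0 \<le> f2 x"
      "\<And>x. x \<in> {a..b} \<Longrightarrow> (f2 has_integral ((V x - w x) - (V a - w a))) {a..x}"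
    using ac_pairs_mono_density[OF ac_pairs_diff[OF acV ac] assms(2)] by blast
  define g where "g x = f1 x - f2 x" for x
  have "f1 integrable_on {a..b}" "f2 integrable_on {a..b}"
    using f1(2)[of b] f2(2)[of b] assms(2) by (auto simp: integrable_on_def)
  then have "f1 absolutely_integrable_on {a..b}" "f2 absolutely_integrable_on {a..b}"
    using f1(1) f2(1) by (auto intro: nonnegative_absolutely_integrable_1)
  then have gabs: "g absolutely_integrable_on {a..b}"
    unfolding g_def[abs_def] by (rule set_integral_diff)
  have gint: "(g has_integral (w x - w a)) {a..x}" if "x \<in> {a..b}" for x
    using has_integral_diff[OF f1(2)[OF that] f2(2)[OF that]] by (simp add: g_def[abs_def])
  obtain N where N: "negligible N"
    "\<And>x. x \<in> {a<..<b} - N \<Longrightarrow> ((\<lambda>y. integral {a..y} g) has_real_derivative g x) (at x)"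
    using integral_has_real_derivative_ae[of g a b] gint[of b] assms(2) by (auto simp: integrable_on_def)
  show thesis
  proof (rule that[OF gabs gint])
    \<comment> \<open>The differentiation theorem covers interior points, so the endpoints join the
      exceptional set.\<close>
    show "negligible (N \<union> {a, b})" using N(1) by simp
    fix x assume x: "x \<in> {a..b} - (N \<union> {a, b})"
    then have "((\<lambda>y. w a + integral {a..y} g) has_real_derivative g x) (at x within {a..b})"
      using DERIV_add[OF DERIV_const[of "w a"] has_field_derivative_at_within[OF N(2)[of x]]] by auto
    then show "(w has_real_derivative g x) (at x within {a..b})"
    proof (rule has_field_derivative_transform_within[of _ _ _ _ 1])
      show "w a + integral {a..y} g = w y" if "y \<in> {a..b}" for y
        using integral_unique[OF gint[OF that]] by simp
    qed (use x in auto)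
  qed
qed

abbreviation ivl_deriv :: "real \<Rightarrow> real \<Rightarrow> (real \<Rightarrow> real) \<Rightarrow> real \<Rightarrow> real" where
  "ivl_deriv a b f x \<equiv> vector_derivative f (at x within {a..b})"

lemma ivl_deriv_eq:
  assumes "(f has_real_derivative d) (at x within {a..b})" "x \<in> {a..b}" "a < b"
  shows "ivl_deriv a b f x = d"
  using assms by (simp add: has_real_derivative_iff_has_vector_derivative vector_derivative_within_closed_interval)

lemma AE_lebesgue_on_negligible:
  assumes "negligible N" "\<And>x. x \<in> S - N \<Longrightarrow> P x" "S \<in> sets lebesgue"
  shows "AE x in lebesgue_on S. P x"
proof -
  have "AE x in lebesgue. x \<notin> N" using assms(1) by (simp add: negligible_iff_null_sets AE_not_in)
  then show ?thesis using assms(2,3) by (auto simp: AE_restrict_space_iff elim!: AE_mp)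
qed

text \<open>The density and the derivative agree off a negligible set, so integrability and
  integrals transfer to \<open>ivl_deriv\<close>, the expression that occurs in
  \<open>JW\<close>.\<close>

lemma absolutely_continuous_on_FTC:
  fixes w :: "real \<Rightarrow> real"
  assumes "absolutely_continuous_on {a..b} w" "a < b"
  shows "AE x in lebesgue_on {a..b}. (w has_real_derivative ivl_deriv a b w x) (at x within {a..b})"
    and "integrable (lebesgue_on {a..b}) (ivl_deriv a b w)"
    and "\<And>x. x \<in> {a..b} \<Longrightarrow> (ivl_deriv a b w has_integral (w x - w a)) {a..x}"
proof -
  obtain g N where g: "g absolutely_integrable_on {a..b}"
    "\<And>x. x \<in> {a..b} \<Longrightarrow> (g has_integral (w x - w a)) {a..x}"
    "negligible N" "\<And>x. x \<in> {a..b} - N \<Longrightarrow> (w has_real_derivative g x) (at x within {a..b})"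
    using absolutely_continuous_on_density[OF assms] by blast
  have eq: "ivl_deriv a b w x = g x" if "x \<in> {a..b} - N" for x
    using ivl_deriv_eq[OF g(4)[OF that]] that assms(2) by simp
  show "AE x in lebesgue_on {a..b}. (w has_real_derivative ivl_deriv a b w x) (at x within {a..b})"
    using g(4) eq by (intro AE_lebesgue_on_negligible[OF g(3)]) auto
  show "integrable (lebesgue_on {a..b}) (ivl_deriv a b w)"
    by (rule absolutely_integrable_imp_integrable[OF absolutely_integrable_spike[OF g(1,3) eq]]) auto
  show "(ivl_deriv a b w has_integral (w x - w a)) {a..x}" if "x \<in> {a..b}" for x
    by (rule has_integral_spike[OF g(3) eq g(2)[OF that]]) (use that in auto)
qed

subsection \<open>Closure properties of absolute continuity\<close>

text \<open>A common criterion behind sums, products of bounded functions and Lipschitz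
  compositions: control of the increments of \<open>h\<close> by those of \<open>f\<close> and
  \<open>g\<close> passes to sums over divisions.\<close>

lemma absolutely_continuous_on_dominated:
  assumes f: "absolutely_continuous_on S f" and g: "absolutely_continuous_on S g"
    and dom: "\<And>x y. x \<in> S \<Longrightarrow> y \<in> S \<Longrightarrow> \<bar>h x - h y\<bar> \<le> B * (\<bar>f x - f y\<bar> + \<bar>g x - g y\<bar>)"
  shows "absolutely_continuous_on S h"
  unfolding absolutely_continuous_on_def
proof (intro allI impI)
  fix \<epsilon> :: real assume "\<epsilon> > 0"
  \<comment> \<open>\<open>B\<close> may be zero or negative; the maximum with 1 gives a positive
    constant to divide by.\<close>
  define C where "C = max B 1"
  have C: "C > 0" "B \<le> C" by (auto simp: C_def)
  define \<epsilon>' where "\<epsilon>' = \<epsilon> / (2 * C)"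
  have "\<epsilon>' > 0" using \<open>\<epsilon> > 0\<close> C by (simp add: \<epsilon>'_def)
  obtain \<delta> where \<delta>: "\<delta> > 0" "\<And>D T. D division_of T \<Longrightarrow> T \<subseteq> S \<Longrightarrow> (\<Sum>K\<in>D. Sup K - Inf K) < \<delta> \<Longrightarrow>
        (\<Sum>K\<in>D. \<bar>f (Sup K) - f (Inf K)\<bar>) < \<epsilon>'"
    using f \<open>\<epsilon>' > 0\<close> unfolding absolutely_continuous_on_def by meson
  obtain \<gamma> where \<gamma>: "\<gamma> > 0" "\<And>D T. D division_of T \<Longrightarrow> T \<subseteq> S \<Longrightarrow> (\<Sum>K\<in>D. Sup K - Inf K) < \<gamma> \<Longrightarrow>
        (\<Sum>K\<in>D. \<bar>g (Sup K) - g (Inf K)\<bar>) < \<epsilon>'"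
    using g \<open>\<epsilon>' > 0\<close> unfolding absolutely_continuous_on_def by meson
  show "\<exists>\<delta>>0. \<forall>D T. D division_of T \<and> T \<subseteq> S \<and> (\<Sum>K\<in>D. Sup K - Inf K) < \<delta> \<longrightarrow>
      (\<Sum>K\<in>D. \<bar>h (Sup K) - h (Inf K)\<bar>) < \<epsilon>"
  proof (intro exI conjI allI impI)
    show "min \<delta> \<gamma> > 0" using \<delta> \<gamma> by simp
    fix D T assume D: "D division_of T \<and> T \<subseteq> S \<and> (\<Sum>K\<in>D. Sup K - Inf K) < min \<delta> \<gamma>"
    have "(\<Sum>K\<in>D. \<bar>h (Sup K) - h (Inf K)\<bar>) \<le>
        (\<Sum>K\<in>D. C * (\<bar>f (Sup K) - f (Inf K)\<bar> + \<bar>g (Sup K) - g (Inf K)\<bar>))"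
    proof (rule sum_mono)
      fix K assume K: "K \<in> D"
      then obtain c d where cd: "K = cbox c d" "K \<noteq> {}" "K \<subseteq> S"
        using D division_ofD(2-4)[of D T K] by (metis order_trans)
      then have "Sup K \<in> S" "Inf K \<in> S" by auto
      then have "\<bar>h (Sup K) - h (Inf K)\<bar> \<le> B * (\<bar>f (Sup K) - f (Inf K)\<bar> + \<bar>g (Sup K) - g (Inf K)\<bar>)"
        by (rule dom)
      also have "\<dots> \<le> C * (\<bar>f (Sup K) - f (Inf K)\<bar> + \<bar>g (Sup K) - g (Inf K)\<bar>)"
        using C by (intro mult_right_mono) auto
      finally show "\<bar>h (Sup K) - h (Inf K)\<bar> \<le> C * (\<bar>f (Sup K) - f (Inf K)\<bar> + \<bar>g (Sup K) - g (Inf K)\<bar>)" .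
    qed
    also have "\<dots> = C * ((\<Sum>K\<in>D. \<bar>f (Sup K) - f (Inf K)\<bar>) + (\<Sum>K\<in>D. \<bar>g (Sup K) - g (Inf K)\<bar>))"
      by (simp add: sum_distrib_left[symmetric] sum.distrib)
    also have "\<dots> < C * (\<epsilon>' + \<epsilon>')"
      using D by (intro mult_strict_left_mono[OF _ C(1)] add_strict_mono \<delta>(2) \<gamma>(2)) auto
    also have "\<dots> = \<epsilon>" using C by (simp add: \<epsilon>'_def)
    finally show "(\<Sum>K\<in>D. \<bar>h (Sup K) - h (Inf K)\<bar>) < \<epsilon>" .
  qed
qed

lemma absolutely_continuous_on_id: "absolutely_continuous_on S (\<lambda>x. x)"
  unfolding absolutely_continuous_on_def
proof (intro allI impI)
  fix \<epsilon> :: real assume "\<epsilon> > 0"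
  show "\<exists>\<delta>>0. \<forall>D T. D division_of T \<and> T \<subseteq> S \<and> (\<Sum>K\<in>D. Sup K - Inf K) < \<delta> \<longrightarrow>
      (\<Sum>K\<in>D. \<bar>Sup K - Inf K\<bar>) < \<epsilon>"
  proof (intro exI conjI allI impI)
    fix D T assume D: "D division_of T \<and> T \<subseteq> S \<and> (\<Sum>K\<in>D. Sup K - Inf K) < \<epsilon>"
    have "\<bar>Sup K - Inf K\<bar> = Sup K - Inf K" if "K \<in> D" for K
    proof -
      obtain c d where "K = cbox c d" "K \<noteq> {}"
        using D \<open>K \<in> D\<close> division_ofD(3,4)[of D T K] by auto
      then show ?thesis by auto
    qed
    with D show "(\<Sum>K\<in>D. \<bar>Sup K - Inf K\<bar>) < \<epsilon>" by (simp cong: sum.cong)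
  qed fact
qed

lemma absolutely_continuous_on_Lipschitz:
  assumes "\<And>x y. x \<in> S \<Longrightarrow> y \<in> S \<Longrightarrow> \<bar>h x - h y\<bar> \<le> B * \<bar>x - y\<bar>"
  shows "absolutely_continuous_on S h"
  \<comment> \<open>Both dominating functions are the identity; their equal increments add up, which
    explains the half.\<close>
  by (rule absolutely_continuous_on_dominated[OF absolutely_continuous_on_id absolutely_continuous_on_id,
        where B = "B / 2"])
     (use assms in auto)

lemma absolutely_continuous_on_add:
  assumes f: "absolutely_continuous_on S f" and g: "absolutely_continuous_on S g"
  shows "absolutely_continuous_on S (\<lambda>x. f x + g x)"
  by (rule absolutely_continuous_on_dominated[OF assms, where B = 1]) auto

lemma absolutely_continuous_on_compose_Lipschitz:
  assumes f: "absolutely_continuous_on S f"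
    and h: "\<And>x y. x \<in> f ` S \<Longrightarrow> y \<in> f ` S \<Longrightarrow> \<bar>h x - h y\<bar> \<le> B * \<bar>x - y\<bar>"
  shows "absolutely_continuous_on S (\<lambda>x. h (f x))"
  by (rule absolutely_continuous_on_dominated[OF f f, where B = "B / 2"]) (use h in auto)

lemma absolutely_continuous_on_mult:
  assumes f: "absolutely_continuous_on S f" and g: "absolutely_continuous_on S g"
    and bd: "\<And>x. x \<in> S \<Longrightarrow> \<bar>f x\<bar> \<le> M" "\<And>x. x \<in> S \<Longrightarrow> \<bar>g x\<bar> \<le> M"
  shows "absolutely_continuous_on S (\<lambda>x. f x * g x)"
proof (rule absolutely_continuous_on_dominated[OF f g, where B = M])
  fix x y assume xy: "x \<in> S" "y \<in> S"
  have "\<bar>f x * g x - f y * g y\<bar> = \<bar>(f x - f y) * g x + f y * (g x - g y)\<bar>" by (simp add: algebra_simps)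
  also have "\<dots> \<le> \<bar>f x - f y\<bar> * \<bar>g x\<bar> + \<bar>f y\<bar> * \<bar>g x - g y\<bar>"
    by (metis abs_mult abs_triangle_ineq)
  also have "\<dots> \<le> \<bar>f x - f y\<bar> * M + M * \<bar>g x - g y\<bar>"
    using bd xy by (intro add_mono mult_left_mono mult_right_mono) auto
  finally show "\<bar>f x * g x - f y * g y\<bar> \<le> M * (\<bar>f x - f y\<bar> + \<bar>g x - g y\<bar>)" by (simp add: algebra_simps)
qed

lemma absolutely_continuous_on_imp_continuous_on:
  "absolutely_continuous_on {a..b} f \<Longrightarrow> continuous_on {a..b} f"
  by (intro ac_pairs_continuous absolutely_continuous_imp_ac_pairs)

text \<open>The derivative may be given by any integrable formula that is right almost everywhere;
  applied to a product, this yields integration by parts.\<close>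

lemma absolutely_continuous_on_integral_deriv:
  assumes f: "absolutely_continuous_on {a..b} f" and "a < b"
    and d: "AE x in lebesgue_on {a..b}. (f has_real_derivative d x) (at x within {a..b})"
    and d_int: "integrable (lebesgue_on {a..b}) d"
  shows "integral\<^sup>L (lebesgue_on {a..b}) d = f b - f a"
proof -
  have "AE x in lebesgue_on {a..b}. d x = ivl_deriv a b f x"
    using d by (rule AE_mp) (use \<open>a < b\<close> in \<open>auto intro!: AE_I2 dest: ivl_deriv_eq\<close>)
  then have "integral\<^sup>L (lebesgue_on {a..b}) d = integral\<^sup>L (lebesgue_on {a..b}) (ivl_deriv a b f)"
    using d_int absolutely_continuous_on_FTC(2)[OF f \<open>a < b\<close>] by (intro integral_cong_AE) auto
  also have "\<dots> = integral {a..b} (ivl_deriv a b f)"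
    using absolutely_continuous_on_FTC(2)[OF f \<open>a < b\<close>] by (intro lebesgue_integral_eq_integral) auto
  also have "\<dots> = f b - f a"
    using absolutely_continuous_on_FTC(3)[OF f \<open>a < b\<close>, of b] \<open>a < b\<close> by (intro integral_unique) auto
  finally show ?thesis .
qed

subsection \<open>Extended integrals\<close>

text \<open>Passing from \<open>f\<close> to \<open>h\<close> raises the positive part and lowers
  the negative part, so the two nonnegative integrals are compared separately.\<close>

lemma extended_integral_mono_AE:
  assumes "AE x in M. f x \<le> h x"
  shows "extended_integral M f \<le> extended_integral M h"
  unfolding extended_integral_def
proof (rule ereal_minus_mono)
  show "enn2ereal (\<integral>\<^sup>+x. ennreal (f x) \<partial>M) \<le> enn2ereal (\<integral>\<^sup>+x. ennreal (h x) \<partial>M)"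
    unfolding less_eq_ennreal.rep_eq[symmetric]
    by (rule nn_integral_mono_AE, rule AE_mp[OF assms]) (auto intro!: AE_I2 ennreal_leI)
  show "enn2ereal (\<integral>\<^sup>+x. ennreal (- h x) \<partial>M) \<le> enn2ereal (\<integral>\<^sup>+x. ennreal (- f x) \<partial>M)"
    unfolding less_eq_ennreal.rep_eq[symmetric]
    by (rule nn_integral_mono_AE, rule AE_mp[OF assms]) (auto intro!: AE_I2 ennreal_leI)
qed

text \<open>On a finite measure space the bounded \<open>p\<close> keeps the integral of the
  negative part finite, so a value below infinity makes that of the positive part finite, and
  \<open>f\<close> is at most the positive part plus \<open>C\<close>. In use \<open>f\<close> is
  the squared derivative and \<open>p\<close> the potential term.\<close>

lemma extended_integral_finite_imp_integrable:
  assumes "finite_measure M" and fin: "extended_integral M (\<lambda>x. f x - p x) < \<infinity>"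
    and f[measurable]: "f \<in> borel_measurable M" and f0: "\<And>x. x \<in> space M \<Longrightarrow> 0 \<le> f x"
    and p[measurable]: "p \<in> borel_measurable M" and pC: "\<And>x. x \<in> space M \<Longrightarrow> \<bar>p x\<bar> \<le> C"
  shows "integrable M f"
proof -
  interpret finite_measure M by fact
  have C: "(\<integral>\<^sup>+x. ennreal C \<partial>M) < \<infinity>"
    by (simp add: less_top[symmetric] ennreal_mult_eq_top_iff)
  have "(\<integral>\<^sup>+x. ennreal (- (f x - p x)) \<partial>M) \<le> (\<integral>\<^sup>+x. ennreal C \<partial>M)"
    using f0 pC by (intro nn_integral_mono ennreal_leI) (smt (verit))
  with C have "(\<integral>\<^sup>+x. ennreal (- (f x - p x)) \<partial>M) < \<infinity>" by (rule le_less_trans[rotated])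
  then obtain r where r: "(\<integral>\<^sup>+x. ennreal (- (f x - p x)) \<partial>M) = ennreal r" "r \<ge> 0"
    by (metis ennreal_cases infinity_ennreal_def less_irrefl)
  have pos: "(\<integral>\<^sup>+x. ennreal (f x - p x) \<partial>M) < \<infinity>"
  \<comment> \<open>An infinite positive part minus the finite value \<open>r\<close> would be
    infinite, contrary to \<open>fin\<close>.\<close>
  proof (rule ccontr)
    assume "\<not> (\<integral>\<^sup>+x. ennreal (f x - p x) \<partial>M) < \<infinity>"
    then have "(\<integral>\<^sup>+x. ennreal (f x - p x) \<partial>M) = \<infinity>" by (simp add: less_top[symmetric])
    then show False using fin r by (simp add: extended_integral_def enn2ereal_ennreal)
  qed
  have "(\<integral>\<^sup>+x. ennreal (f x) \<partial>M) \<le> (\<integral>\<^sup>+x. ennreal (f x - p x) + ennreal C \<partial>M)"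
  proof (rule nn_integral_mono)
    fix x assume x: "x \<in> space M"
    have "ennreal (f x) \<le> ennreal (max 0 (f x - p x) + C)"
      using pC[OF x] by (intro ennreal_leI) linarith
    also have "\<dots> = ennreal (f x - p x) + ennreal C"
      using pC[OF x] by (subst ennreal_plus) (auto simp: max_def ennreal_neg)
    finally show "ennreal (f x) \<le> ennreal (f x - p x) + ennreal C" .
  qed
  also have "\<dots> = (\<integral>\<^sup>+x. ennreal (f x - p x) \<partial>M) + (\<integral>\<^sup>+x. ennreal C \<partial>M)"
    by (rule nn_integral_add) auto
  also have "\<dots> < \<infinity>" using pos C by (simp add: less_top[symmetric] ennreal_add_eq_top)
  finally have "(\<integral>\<^sup>+x. ennreal (f x) \<partial>M) < \<infinity>" .
  then show ?thesis
    using f0 by (intro integrableI_nonneg) (auto intro!: AE_I2)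
qed

subsection \<open>Elementary estimates\<close>

text \<open>The inequality of difference quotients passes to the limit; it is applied to a curve and
  its folded image.\<close>

lemma derivative_abs_le:
  fixes v z :: "real \<Rightarrow> real"
  assumes v: "(v has_real_derivative q) (at x within S)" and z: "(z has_real_derivative d) (at x within S)"
    and le: "\<And>y. y \<in> S \<Longrightarrow> \<bar>v y - v x\<bar> \<le> \<bar>z y - z x\<bar>" and "at x within S \<noteq> bot"
  shows "\<bar>q\<bar> \<le> \<bar>d\<bar>"
proof (rule tendsto_le)
  show "((\<lambda>y. \<bar>(z y - z x) / (y - x)\<bar>) \<longlongrightarrow> \<bar>d\<bar>) (at x within S)"
    using z by (intro tendsto_rabs) (simp add: has_field_derivative_iff)
  show "((\<lambda>y. \<bar>(v y - v x) / (y - x)\<bar>) \<longlongrightarrow> \<bar>q\<bar>) (at x within S)"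
    using v by (intro tendsto_rabs) (simp add: has_field_derivative_iff)
  show "\<forall>\<^sub>F y in at x within S. \<bar>(v y - v x) / (y - x)\<bar> \<le> \<bar>(z y - z x) / (y - x)\<bar>"
    using le by (auto simp: eventually_at_filter intro!: always_eventually divide_right_mono)
qed fact

text \<open>For small \<open>e\<close> of sign opposite to \<open>a\<close> the linear term would
  dominate and make the expression negative.\<close>

lemma linear_le_quadratic_imp_zero:
  fixes a c e0 :: real
  assumes "e0 > 0" "\<And>e. \<bar>e\<bar> \<le> e0 \<Longrightarrow> 0 \<le> e * a + e\<^sup>2 * c"
  shows "a = 0"
proof (rule ccontr)
  assume "a \<noteq> 0"
  \<comment> \<open>This size ensures \<open>s * c \<le> \<bar>a\<bar> / 2\<close>; adding 1 to
    \<open>\<bar>c\<bar>\<close> avoids division by zero.\<close>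
  define s where "s = min e0 (\<bar>a\<bar> / (2 * (\<bar>c\<bar> + 1)))"
  have s: "s > 0" "s \<le> e0" using assms(1) \<open>a \<noteq> 0\<close> by (auto simp: s_def)
  have "s * (\<bar>c\<bar> + 1) \<le> \<bar>a\<bar> / (2 * (\<bar>c\<bar> + 1)) * (\<bar>c\<bar> + 1)"
    by (intro mult_right_mono) (auto simp: s_def)
  also have "\<dots> = \<bar>a\<bar> / 2" by (simp add: field_simps)
  finally have "s * (\<bar>c\<bar> + 1) \<le> \<bar>a\<bar> / 2" .
  moreover have "s * c \<le> s * (\<bar>c\<bar> + 1)" using s by (intro mult_left_mono) auto
  ultimately have "s * c < \<bar>a\<bar>" using \<open>a \<noteq> 0\<close> by simp
  have "0 \<le> (- sgn a * s) * a + (- sgn a * s)\<^sup>2 * c"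
    using s \<open>a \<noteq> 0\<close> by (intro assms(2)) (auto simp: abs_mult abs_sgn_eq)
  also have "\<dots> = s * (s * c - \<bar>a\<bar>)"
    using \<open>a \<noteq> 0\<close> by (auto simp: sgn_if power2_eq_square algebra_simps)
  also have "\<dots> < 0" using s \<open>s * c < \<bar>a\<bar>\<close> by (simp add: mult_less_0_iff)
  finally show False by simp
qed

text \<open>The mean value theorem gives \<open>sin (a + h) - sin a = h * cos z\<close> with
  \<open>z\<close> within \<open>\<bar>h\<bar>\<close> of \<open>a\<close>, and cosine is
  1-Lipschitz.\<close>

lemma sin_taylor1:
  fixes a h :: real
  shows "\<bar>sin (a + h) - sin a - h * cos a\<bar> \<le> h\<^sup>2"
proof (cases "h = 0")
  case False
  have cosL: "\<bar>cos x - cos y\<bar> \<le> \<bar>x - y\<bar>" for x y :: real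
  proof -
    have "\<bar>cos x - cos y\<bar> = 2 * \<bar>sin ((x + y) / 2)\<bar> * \<bar>sin ((y - x) / 2)\<bar>"
      by (simp add: cos_diff_cos abs_mult)
    also have "\<dots> \<le> 2 * 1 * \<bar>(y - x) / 2\<bar>"
      by (intro mult_mono abs_sin_x_le_abs_x abs_sin_le_one) auto
    finally show ?thesis by (simp add: abs_minus_commute)
  qed
  have "\<exists>z. \<bar>z - a\<bar> \<le> \<bar>h\<bar> \<and> sin (a + h) - sin a = h * cos z"
  proof (cases "h > 0")
    case True
    then obtain z where "a < z" "z < a + h" "sin (a + h) - sin a = (a + h - a) * cos z"
      using MVT2[of a "a + h" sin cos] by auto
    then show ?thesis by (intro exI[of _ z]) auto
  next
    case False
    then obtain z where "a + h < z" "z < a" "sin a - sin (a + h) = (a - (a + h)) * cos z"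
      using MVT2[of "a + h" a sin cos] \<open>h \<noteq> 0\<close> by auto
    then show ?thesis by (intro exI[of _ z]) auto
  qed
  then obtain z where z: "\<bar>z - a\<bar> \<le> \<bar>h\<bar>" "sin (a + h) - sin a = h * cos z" by blast
  have "\<bar>sin (a + h) - sin a - h * cos a\<bar> = \<bar>h\<bar> * \<bar>cos z - cos a\<bar>"
    unfolding z(2) by (simp add: right_diff_distrib[symmetric] abs_mult)
  also have "\<dots> \<le> \<bar>h\<bar> * \<bar>h\<bar>" using cosL[of z a] z(1) by (intro mult_left_mono) auto
  finally show ?thesis by (simp add: power2_eq_square)
qed simp

definition fold_half_pi :: "real \<Rightarrow> real" where
  "fold_half_pi x = (if x > pi / 2 then pi - x else if x < - pi / 2 then - pi - x else x)"

text \<open>The folding is continuous and piecewise affine with slopes 1 and -1.\<close>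

lemma fold_half_pi_Lipschitz: "\<bar>fold_half_pi x - fold_half_pi y\<bar> \<le> \<bar>x - y\<bar>"
  using pi_gt_zero unfolding fold_half_pi_def by (smt (verit) field_sum_of_halves)

text \<open>One reflection is enough: an overshoot of at most 1 is less than the length pi of the
  target interval.\<close>

lemma fold_half_pi_range: "\<bar>x\<bar> \<le> pi / 2 + 1 \<Longrightarrow> fold_half_pi x \<in> {- pi / 2..pi / 2}"
  using pi_gt3 by (auto simp: fold_half_pi_def)

lemma sin_fold_half_pi: "sin (fold_half_pi x) = sin x"
proof -
  have "sin (- pi - x) = sin x" using sin_minus[of "pi + x"] by (simp add: sin_add)
  then show ?thesis by (simp add: fold_half_pi_def)
qed

subsection \<open>Piecewise continuous functions\<close>

lemma piecewise_continuous_cover: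
  fixes t :: "nat \<Rightarrow> real"
  assumes "t 0 \<le> x" "x \<le> t n"
  shows "x \<in> t ` {..n} \<or> (\<exists>i<n. t i < x \<and> x < t (Suc i))"
  using assms(2)
proof (induction n)
  case 0
  then show ?case using assms(1) by auto
next
  case (Suc n)
  show ?case
  proof (cases "x \<le> t n")
    case True
    with Suc.IH show ?thesis by (auto simp: atMost_Suc less_Suc_eq)
  next
    case False
    then show ?thesis using Suc.prems by (cases "x = t (Suc n)") auto
  qed
qed

text \<open>Filling in the one-sided limits at the endpoints gives a continuous function on a
  compact interval.\<close>

lemma bounded_on_open_interval_with_limits:
  fixes u :: "real \<Rightarrow> real"
  assumes "a < b" "continuous_on {a<..<b} u" "(u \<longlongrightarrow> l) (at_right a)" "(u \<longlongrightarrow> r) (at_left b)"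
  shows "\<exists>B. \<forall>x\<in>{a<..<b}. \<bar>u x\<bar> \<le> B"
proof -
  define v where "v x = (if x \<le> a then l else if b \<le> x then r else u x)" for x
  have ev: "\<forall>\<^sub>F y in at x. v y = u y" if "a < x" "x < b" for x
    using eventually_at_in_open'[of "{a<..<b}" x] that
    by (auto elim!: eventually_mono simp: v_def)
  have "continuous_on {a..b} v"
  proof (rule continuous_on_IccI)
    have "\<forall>\<^sub>F y in at_right a. v y = u y"
      using eventually_at_right_real[OF \<open>a < b\<close>] by eventually_elim (auto simp: v_def)
    then show "(v \<longlongrightarrow> v a) (at_right a)"
      using assms(3) by (simp add: tendsto_cong v_def)
    have "\<forall>\<^sub>F y in at_left b. v y = u y"
      using eventually_at_left_real[OF \<open>a < b\<close>] by eventually_elim (auto simp: v_def)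
    then show "(v \<longlongrightarrow> v b) (at_left b)"
      using assms(1,4) by (simp add: tendsto_cong v_def)
    show "v \<midarrow>x\<rightarrow> v x" if "a < x" "x < b" for x
    proof -
      have "u \<midarrow>x\<rightarrow> u x"
        using assms(2) that by (simp add: continuous_on_eq_continuous_at isCont_def)
      then show ?thesis using that by (simp add: tendsto_cong[OF ev[OF that]] v_def)
    qed
  qed fact
  then have "bounded (v ` {a..b})" by (intro compact_imp_bounded compact_continuous_image) auto
  then obtain B where "\<forall>x\<in>{a..b}. \<bar>v x\<bar> \<le> B" by (auto simp: bounded_iff)
  moreover have "v x = u x" if "x \<in> {a<..<b}" for x using that by (simp add: v_def)
  ultimately have "\<forall>x\<in>{a<..<b}. \<bar>u x\<bar> \<le> B" by (metis greaterThanLessThan_subseteq_atLeastAtMost_iff order_refl subsetD)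
  then show ?thesis by blast
qed

lemma piecewise_continuous_bounded:
  assumes "piecewise_continuous_wrt N t u"
  obtains B P where "finite P" "0 \<le> B" "\<And>x. x \<in> {0..1} \<Longrightarrow> \<bar>u x\<bar> \<le> B"
    "\<And>x. x \<in> {0..1} - P \<Longrightarrow> isCont u x"
proof -
  have t: "t 0 = 0" "t N = 1" "\<And>i. i < N \<Longrightarrow> t i < t (Suc i)"
    "\<And>i. i < N \<Longrightarrow> continuous_on {t i<..<t (Suc i)} u"
    "\<And>i. i \<in> {1..N} \<Longrightarrow> \<exists>l. (u \<longlongrightarrow> l) (at_left (t i))"
    "\<And>i. i < N \<Longrightarrow> \<exists>l. (u \<longlongrightarrow> l) (at_right (t i))"
    using assms unfolding piecewise_continuous_wrt_def by blast+
  have "\<exists>B. \<forall>x\<in>{t i<..<t (Suc i)}. \<bar>u x\<bar> \<le> B" if "i < N" for i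
    using bounded_on_open_interval_with_limits[OF t(3,4)[OF that]] t(6)[OF that] t(5)[of "Suc i"] that
    by fastforce
  then obtain C where C: "\<And>i x. i < N \<Longrightarrow> x \<in> {t i<..<t (Suc i)} \<Longrightarrow> \<bar>u x\<bar> \<le> C i" by metis
  \<comment> \<open>The sums dominate the bound on each piece and each value \<open>u (t i)\<close>;
    these values are unrelated to the one-sided limits and must be included separately.\<close>
  define B where "B = (\<Sum>i<N. \<bar>C i\<bar>) + (\<Sum>i\<le>N. \<bar>u (t i)\<bar>)"
  have nonneg: "0 \<le> (\<Sum>i<N. \<bar>C i\<bar>)" "0 \<le> (\<Sum>i\<le>N. \<bar>u (t i)\<bar>)" by (auto intro: sum_nonneg)
  have B1: "\<bar>C i\<bar> \<le> B" if "i < N" for i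
    unfolding B_def
    by (rule add_increasing2[OF nonneg(2) member_le_sum]) (use that in auto)
  have B2: "\<bar>u (t i)\<bar> \<le> B" if "i \<le> N" for i
    unfolding B_def
    by (rule add_increasing[OF nonneg(1) member_le_sum]) (use that in auto)
  show thesis
  proof (rule that)
    show "finite (t ` {..N})" by simp
    show "0 \<le> B" by (auto simp: B_def intro!: add_nonneg_nonneg sum_nonneg)
    show "\<bar>u x\<bar> \<le> B" if "x \<in> {0..1}" for x
      using piecewise_continuous_cover[of t x N] that t(1,2) B1 B2 C by fastforce
    show "isCont u x" if x: "x \<in> {0..1} - t ` {..N}" for x
    proof -
      obtain i where i: "i < N" "t i < x" "x < t (Suc i)"
        using piecewise_continuous_cover[of t x N] x t(1,2) by auto
      then show ?thesis using t(4)[OF i(1)] by (simp add: continuous_on_eq_continuous_at)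
    qed
  qed
qed

section \<open>Measurability and integrability on an interval\<close>

text \<open>Cut off outside \<open>[a, b]\<close>, the function is continuous except possibly at
  finitely many points: those of \<open>P\<close> and the endpoints, where the cutoff may
  jump.\<close>

lemma borel_measurable_lebesgue_on_finite_exceptions:
  fixes u :: "real \<Rightarrow> real"
  assumes "finite P" "\<And>x. x \<in> {a..b} - P \<Longrightarrow> isCont u x"
  shows "u \<in> borel_measurable (lebesgue_on {a..b})"
proof -
  define v where "v x = (if x \<in> {a..b} then u x else 0)" for x
  have "v \<in> borel_measurable borel"
  proof (rule borel_measurable_continuous_countable_exceptions[of "P \<union> {a, b}"])
    show "continuous_on (- (P \<union> {a, b})) v"
    proof (rule continuous_at_imp_continuous_on, rule ballI)
      fix x assume x: "x \<in> - (P \<union> {a, b})"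
      show "isCont v x"
      proof (cases "x \<in> {a..b}")
        case True
        have "\<forall>\<^sub>F y in nhds x. v y = u y"
          using eventually_nhds_in_open[of "{a<..<b}" x] True x
          by (auto elim!: eventually_mono simp: v_def)
        then show ?thesis using assms(2)[of x] True x by (simp add: isCont_cong)
      next
        case False
        have "\<forall>\<^sub>F y in nhds x. v y = 0"
          using eventually_nhds_in_open[OF open_Compl[OF closed_atLeastAtMost], of x a b] False
          by (auto elim!: eventually_mono simp: v_def)
        then show ?thesis by (simp add: isCont_cong)
      qed
    qed
  qed (use assms(1) in \<open>simp add: countable_finite\<close>)
  then have "v \<in> borel_measurable (lebesgue_on {a..b})"
    by (intro measurable_restrict_space1 measurable_completion) simp
  then show ?thesis by (subst measurable_cong[of _ _ v]) (auto simp: v_def)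
qed

lemma AE_lebesgue_on_negligibleE:
  assumes "AE x in lebesgue_on S. P x" "S \<in> sets lebesgue"
  obtains N where "negligible N" "\<And>x. x \<in> S - N \<Longrightarrow> P x"
proof -
  have "AE x in lebesgue. x \<in> S \<longrightarrow> P x" using assms by (simp add: AE_restrict_space_iff)
  then obtain N where "N \<in> null_sets lebesgue" "{x. \<not> (x \<in> S \<longrightarrow> P x)} \<subseteq> N"
    by (auto simp: eventually_ae_filter)
  then show thesis by (intro that[of N]) (auto simp: negligible_iff_null_sets)
qed

lemma integrable_lebesgue_on_bounded:
  fixes f :: "real \<Rightarrow> real"
  assumes "f \<in> borel_measurable (lebesgue_on {a..b})" "\<And>x. x \<in> {a..b} \<Longrightarrow> \<bar>f x\<bar> \<le> C"
  shows "integrable (lebesgue_on {a..b}) f"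
proof -
  interpret finite_measure "lebesgue_on {a..b}" by (rule finite_measure_lebesgue_on) simp
  show ?thesis using assms by (intro integrable_const_bound[of _ C]) (auto intro!: AE_I2)
qed

lemma integrable_mult_square_integrable:
  fixes f g :: "'a \<Rightarrow> real"
  assumes [measurable]: "f \<in> borel_measurable M" "g \<in> borel_measurable M"
    and "integrable M (\<lambda>x. (f x)\<^sup>2)" "integrable M (\<lambda>x. (g x)\<^sup>2)"
  shows "integrable M (\<lambda>x. f x * g x)"
proof (rule Bochner_Integration.integrable_bound)
  show "integrable M (\<lambda>x. (f x)\<^sup>2 + (g x)\<^sup>2)" using assms by simp
  show "AE x in M. norm (f x * g x) \<le> norm ((f x)\<^sup>2 + (g x)\<^sup>2)"
  proof (rule AE_I2)
    fix x
    have "2 * (\<bar>f x\<bar> * \<bar>g x\<bar>) \<le> (f x)\<^sup>2 + (g x)\<^sup>2"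
      using sum_squares_bound[of "\<bar>f x\<bar>" "\<bar>g x\<bar>"] by simp
    moreover have "0 \<le> \<bar>f x\<bar> * \<bar>g x\<bar>" by simp
    ultimately have "\<bar>f x\<bar> * \<bar>g x\<bar> \<le> (f x)\<^sup>2 + (g x)\<^sup>2" by linarith
    then show "norm (f x * g x) \<le> norm ((f x)\<^sup>2 + (g x)\<^sup>2)" by (simp add: abs_mult)
  qed
qed simp

lemma integral_Lipschitz:
  fixes f :: "real \<Rightarrow> real"
  assumes f: "f integrable_on {a..b}" and bd: "\<And>x. x \<in> {a..b} \<Longrightarrow> \<bar>f x\<bar> \<le> C"
    and xy: "x \<in> {a..b}" "y \<in> {a..b}"
  shows "\<bar>integral {a..x} f - integral {a..y} f\<bar> \<le> C * \<bar>x - y\<bar>"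
proof -
  have *: "\<bar>integral {a..d} f - integral {a..c} f\<bar> \<le> C * \<bar>d - c\<bar>" if "a \<le> c" "c \<le> d" "d \<le> b" for c d
  proof -
    have int: "f integrable_on {a..d}" "f integrable_on {c..d}"
      using f that by (auto intro: integrable_on_subinterval)
    have "integral {a..c} f + integral {c..d} f = integral {a..d} f"
      using that int by (intro Henstock_Kurzweil_Integration.integral_combine)
    then have "integral {a..d} f - integral {a..c} f = integral {c..d} f" by simp
    moreover have "norm (integral {c..d} f) \<le> integral {c..d} (\<lambda>x. C)"
      using int bd that by (intro integral_norm_bound_integral) auto
    ultimately show ?thesis using that by (simp add: mult.commute)
  qed
  show ?thesis
    using *[of x y] *[of y x] xy by (cases "x \<le> y") (auto simp: abs_minus_commute)
qed

subsection \<open>The Euler equation\<close>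

lemma JW_eq_integral:
  assumes "integrable (lebesgue_on {0..1})
      (\<lambda>x. (ivl_deriv 0 1 w x)\<^sup>2 - u x * ((1 + sin (w x)) / 2))"
  shows "JW u w = ereal (\<integral>x. (ivl_deriv 0 1 w x)\<^sup>2 - u x * ((1 + sin (w x)) / 2) \<partial>lebesgue_on {0..1})"
  unfolding JW_def using assms by (rule extended_integral_eq_integral)

lemma abs_potential_le: "\<bar>c\<bar> \<le> B \<Longrightarrow> \<bar>c * ((1 + sin x) / 2)\<bar> \<le> (B::real)"
proof -
  assume "\<bar>c\<bar> \<le> B"
  have "\<bar>(1 + s) / 2\<bar> \<le> 1" if "- 1 \<le> s" "s \<le> 1" for s :: real
    using that by (simp add: abs_le_iff)
  from this[OF sin_ge_minus_one sin_le_one] have "\<bar>(1 + sin x) / 2\<bar> \<le> 1" .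
  then have "\<bar>c\<bar> * \<bar>(1 + sin x) / 2\<bar> \<le> B * 1" using \<open>\<bar>c\<bar> \<le> B\<close> by (intro mult_mono) auto
  then show ?thesis by (simp add: abs_mult)
qed

text \<open>The potential term is bounded by \<open>B\<close>, so a finite value of the functional
  bounds the kinetic term. Square integrability is what makes the products with test derivatives
  integrable later.\<close>

lemma solution_W_square_integrable:
  assumes sol: "solution_W u w"
    and u: "u \<in> borel_measurable (lebesgue_on {0..1})" "\<And>x. x \<in> {0..1} \<Longrightarrow> \<bar>u x\<bar> \<le> B"
  shows "integrable (lebesgue_on {0..1}) (\<lambda>x. (ivl_deriv 0 1 w x)\<^sup>2)"
proof -
  have ac: "absolutely_continuous_on {0..1} w" and fin: "JW u w < \<infinity>"
    using sol by (auto simp: solution_W_def admissible_W_def)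
  have "w \<in> borel_measurable (lebesgue_on {0..1})"
    using absolutely_continuous_on_imp_continuous_on[OF ac]
    by (rule continuous_imp_measurable_on_sets_lebesgue) simp
  moreover have "ivl_deriv 0 1 w \<in> borel_measurable (lebesgue_on {0..1})"
    using absolutely_continuous_on_FTC(2)[OF ac] by auto
  moreover have "finite_measure (lebesgue_on {0..1::real})"
    by (rule finite_measure_lebesgue_on) simp
  ultimately show ?thesis
    using fin u abs_potential_le[of "u _" B "w _"]
    by (intro extended_integral_finite_imp_integrable[of _ _ "\<lambda>x. u x * ((1 + sin (w x)) / 2)" B])
      (auto simp: JW_def)
qed

text \<open>Folding \<open>z\<close> gives an admissible competitor with the same sine and, almost
  everywhere, no larger slope. Minimality can thus be tested with curves that leave the constraint
  interval by up to 1.\<close>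

lemma solution_W_comparison:
  assumes sol: "solution_W u w"
    and z: "absolutely_continuous_on {0..1} z" "\<And>x. x \<in> {0..1} \<Longrightarrow> \<bar>z x\<bar> \<le> pi / 2 + 1"
    and d: "AE x in lebesgue_on {0..1}. (z has_real_derivative d x) (at x within {0..1})"
    and int: "integrable (lebesgue_on {0..1}) (\<lambda>x. (d x)\<^sup>2 - u x * ((1 + sin (z x)) / 2))"
  shows "JW u w \<le> ereal (\<integral>x. (d x)\<^sup>2 - u x * ((1 + sin (z x)) / 2) \<partial>lebesgue_on {0..1})"
proof -
  define v where "v x = fold_half_pi (z x)" for x
  have acv: "absolutely_continuous_on {0..1} v"
    unfolding v_def[abs_def] using fold_half_pi_Lipschitz
    by (intro absolutely_continuous_on_compose_Lipschitz[OF z(1), where B = 1]) simp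
  then have "admissible_W v"
    using z(2) fold_half_pi_range unfolding admissible_W_def v_def by blast
  then have "JW u w \<le> JW u v" using sol by (auto simp: solution_W_def)
  also have "JW u v \<le> extended_integral (lebesgue_on {0..1}) (\<lambda>x. (d x)\<^sup>2 - u x * ((1 + sin (z x)) / 2))"
    unfolding JW_def
  proof (rule extended_integral_mono_AE)
    have dv: "AE x in lebesgue_on {0..1}. (v has_real_derivative ivl_deriv 0 1 v x) (at x within {0..1})"
      using absolutely_continuous_on_FTC(1)[OF acv] by simp
    show "AE x in lebesgue_on {0..1}. (ivl_deriv 0 1 v x)\<^sup>2 - u x * ((1 + sin (v x)) / 2)
        \<le> (d x)\<^sup>2 - u x * ((1 + sin (z x)) / 2)"
      using dv d AE_space
    proof eventually_elim
      case (elim x)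
      have "\<bar>ivl_deriv 0 1 v x\<bar> \<le> \<bar>d x\<bar>"
      proof (rule derivative_abs_le[OF elim(1,2)])
        show "\<bar>v y - v x\<bar> \<le> \<bar>z y - z x\<bar>" for y unfolding v_def by (rule fold_half_pi_Lipschitz)
        show "at x within {0..1} \<noteq> bot" using elim(3) by (simp add: trivial_limit_within islimpt_Icc)
      qed
      then have "(ivl_deriv 0 1 v x)\<^sup>2 \<le> (d x)\<^sup>2" by (simp add: abs_le_square_iff)
      then show ?case by (simp add: v_def sin_fold_half_pi)
    qed
  qed
  also have "\<dots> = ereal (\<integral>x. (d x)\<^sup>2 - u x * ((1 + sin (z x)) / 2) \<partial>lebesgue_on {0..1})"
    using int by (rule extended_integral_eq_integral)
  finally show ?thesis .
qed

text \<open>First variation along \<open>w + e * \<eta>\<close>: the increment of the functional is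
  at most \<open>e\<close> times the stated integral plus a multiple of \<open>e\<^sup>2\<close>,
  for small \<open>e\<close> of either sign, so the integral vanishes.\<close>

lemma solution_W_Euler_weak:
  assumes sol: "solution_W u w"
    and u[measurable]: "u \<in> borel_measurable (lebesgue_on {0..1})"
    and B: "\<And>x. x \<in> {0..1} \<Longrightarrow> \<bar>u x\<bar> \<le> B" "0 \<le> B"
    and \<eta>: "absolutely_continuous_on {0..1} \<eta>"
    and d\<eta>: "AE x in lebesgue_on {0..1}. (\<eta> has_real_derivative \<phi> x) (at x within {0..1})"
    and \<phi>[measurable]: "\<phi> \<in> borel_measurable (lebesgue_on {0..1})"
    and \<phi>2: "integrable (lebesgue_on {0..1}) (\<lambda>x. (\<phi> x)\<^sup>2)"
  shows "(\<integral>x. 2 * (ivl_deriv 0 1 w x * \<phi> x) - u x * cos (w x) * \<eta> x / 2 \<partial>lebesgue_on {0..1}) = 0"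
proof -
  let ?L = "lebesgue_on {0..1::real}"
  define g where "g = ivl_deriv 0 1 w"
  have ac: "absolutely_continuous_on {0..1} w" and wPi: "w \<in> {0..1} \<rightarrow> {- pi / 2..pi / 2}"
    using sol by (auto simp: solution_W_def admissible_W_def)
  have wr: "\<bar>w x\<bar> \<le> pi / 2" if "x \<in> {0..1}" for x
    using Pi_mem[OF wPi that] unfolding atLeastAtMost_iff abs_le_iff by linarith
  have dw: "AE x in ?L. (w has_real_derivative g x) (at x within {0..1})"
    and [measurable]: "g \<in> borel_measurable ?L"
    using absolutely_continuous_on_FTC[OF ac] by (auto simp: g_def)
  have g2: "integrable ?L (\<lambda>x. (g x)\<^sup>2)"
    unfolding g_def by (rule solution_W_square_integrable[OF sol u B(1)])
  have [measurable]: "w \<in> borel_measurable ?L" "\<eta> \<in> borel_measurable ?L"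
    using absolutely_continuous_on_imp_continuous_on[OF ac] absolutely_continuous_on_imp_continuous_on[OF \<eta>]
    by (auto intro!: continuous_imp_measurable_on_sets_lebesgue)
  have "bounded (\<eta> ` {0..1})"
    using absolutely_continuous_on_imp_continuous_on[OF \<eta>]
    by (intro compact_imp_bounded compact_continuous_image) auto
  then obtain M where M: "M > 0" "\<And>x. x \<in> {0..1} \<Longrightarrow> \<bar>\<eta> x\<bar> \<le> M"
    by (auto simp: bounded_pos)
  have g\<phi>: "integrable ?L (\<lambda>x. g x * \<phi> x)"
    using g2 \<phi>2 by (intro integrable_mult_square_integrable) auto
  have u\<eta>: "integrable ?L (\<lambda>x. u x * cos (w x) * \<eta> x)"
  proof (rule integrable_lebesgue_on_bounded)
    fix x :: real assume x: "x \<in> {0..1}"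
    show "\<bar>u x * cos (w x) * \<eta> x\<bar> \<le> B * 1 * M"
      unfolding abs_mult using B x M by (intro mult_mono abs_cos_le_one) auto
  qed simp
  have pot: "integrable ?L (\<lambda>x. u x * ((1 + sin (z x)) / 2))" if [measurable]: "z \<in> borel_measurable ?L" for z
    using abs_potential_le[OF B(1)] by (intro integrable_lebesgue_on_bounded) auto
  have lin: "integrable ?L (\<lambda>x. 2 * (g x * \<phi> x) - u x * cos (w x) * \<eta> x / 2)"
    using g\<phi> u\<eta> by auto
  \<comment> \<open>Bound on the second-order terms: the square of \<open>\<phi>\<close> comes from
    the kinetic part, and \<open>B * M\<^sup>2 / 2\<close> from the sine remainder
    \<open>(e * \<eta> x)\<^sup>2\<close> with the factor \<open>u x / 2\<close>.\<close>
  have quad: "integrable ?L (\<lambda>x. (\<phi> x)\<^sup>2 + B * M\<^sup>2 / 2)" using \<phi>2 by auto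
  have base: "integrable ?L (\<lambda>x. (g x)\<^sup>2 - u x * ((1 + sin (w x)) / 2))" using g2 pot[of w] by auto
  \<comment> \<open>For \<open>\<bar>e\<bar> \<le> 1 / M\<close> the perturbation stays within 1,
    the margin allowed by \<open>solution_W_comparison\<close>.\<close>
  have "0 \<le> e * (\<integral>x. 2 * (g x * \<phi> x) - u x * cos (w x) * \<eta> x / 2 \<partial>?L)
      + e\<^sup>2 * (\<integral>x. (\<phi> x)\<^sup>2 + B * M\<^sup>2 / 2 \<partial>?L)" if e: "\<bar>e\<bar> \<le> 1 / M" for e
  proof -
    define z where "z x = w x + e * \<eta> x" for x
    have e\<eta>: "\<bar>e * \<eta> x\<bar> \<le> 1" if "x \<in> {0..1}" for x
    proof -
      have "\<bar>e * \<eta> x\<bar> \<le> (1 / M) * M" unfolding abs_mult using e M(1) M(2)[OF that] by (intro mult_mono) auto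
      then show ?thesis using M(1) by simp
    qed
    have acz: "absolutely_continuous_on {0..1} z" unfolding z_def[abs_def]
      by (intro absolutely_continuous_on_add[OF ac] absolutely_continuous_on_compose_Lipschitz[OF \<eta>, where B = "\<bar>e\<bar>"])
        (simp add: abs_mult[symmetric] right_diff_distrib)
    have zb: "\<bar>z x\<bar> \<le> pi / 2 + 1" if "x \<in> {0..1}" for x
      using wr[OF that] e\<eta>[OF that] unfolding z_def by linarith
    have dz: "AE x in ?L. (z has_real_derivative g x + e * \<phi> x) (at x within {0..1})"
      using dw d\<eta> by eventually_elim (auto simp: z_def[abs_def] intro!: derivative_eq_intros)
    have [measurable]: "z \<in> borel_measurable ?L" unfolding z_def[abs_def] by measurable
    have sq: "(g x + e * \<phi> x)\<^sup>2 = (g x)\<^sup>2 + 2 * e * (g x * \<phi> x) + e\<^sup>2 * (\<phi> x)\<^sup>2" for x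
      by (simp add: power2_eq_square algebra_simps)
    have int: "integrable ?L (\<lambda>x. (g x + e * \<phi> x)\<^sup>2 - u x * ((1 + sin (z x)) / 2))"
      using pot[of z] g2 g\<phi> \<phi>2 unfolding sq by auto
    have "ereal (\<integral>x. (g x)\<^sup>2 - u x * ((1 + sin (w x)) / 2) \<partial>?L) = JW u w"
      using JW_eq_integral[of w u] base by (simp add: g_def)
    also have "\<dots> \<le> ereal (\<integral>x. (g x + e * \<phi> x)\<^sup>2 - u x * ((1 + sin (z x)) / 2) \<partial>?L)"
      by (rule solution_W_comparison[OF sol acz zb dz int])
    finally have "(\<integral>x. (g x)\<^sup>2 - u x * ((1 + sin (w x)) / 2) \<partial>?L)
        \<le> (\<integral>x. (g x + e * \<phi> x)\<^sup>2 - u x * ((1 + sin (z x)) / 2) \<partial>?L)" by simp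
    also have "\<dots> \<le> (\<integral>x. ((g x)\<^sup>2 - u x * ((1 + sin (w x)) / 2)) + (e * (2 * (g x * \<phi> x) - u x * cos (w x) * \<eta> x / 2)
        + e\<^sup>2 * ((\<phi> x)\<^sup>2 + B * M\<^sup>2 / 2)) \<partial>?L)"
    proof (rule integral_mono[OF int])
      fix x assume "x \<in> space ?L"
      then have x: "x \<in> {0..1}" by simp
      define r where "r = sin (z x) - sin (w x) - (e * \<eta> x) * cos (w x)"
      have "\<bar>r\<bar> \<le> (e * \<eta> x)\<^sup>2" unfolding r_def z_def by (rule sin_taylor1)
      also have "\<dots> \<le> e\<^sup>2 * M\<^sup>2"
        unfolding power_mult_distrib using M(1) M(2)[OF x]
        by (intro mult_left_mono) (auto simp: abs_le_square_iff[symmetric])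
      finally have "\<bar>u x\<bar> * \<bar>r\<bar> \<le> B * (e\<^sup>2 * M\<^sup>2)" using B x by (intro mult_mono) auto
      then have "- (u x * r) \<le> B * (e\<^sup>2 * M\<^sup>2)" by (simp add: abs_mult[symmetric])
      moreover have "u x * r = u x * sin (z x) - u x * sin (w x) - e * (u x * cos (w x) * \<eta> x)"
        by (simp add: r_def algebra_simps)
      ultimately have "u x * sin (w x) + e * (u x * cos (w x) * \<eta> x) - u x * sin (z x) \<le> B * (e\<^sup>2 * M\<^sup>2)"
        by linarith
      then show "(g x + e * \<phi> x)\<^sup>2 - u x * ((1 + sin (z x)) / 2)
        \<le> ((g x)\<^sup>2 - u x * ((1 + sin (w x)) / 2)) + (e * (2 * (g x * \<phi> x) - u x * cos (w x) * \<eta> x / 2)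
        + e\<^sup>2 * ((\<phi> x)\<^sup>2 + B * M\<^sup>2 / 2))"
        by (simp add: power2_sum power_mult_distrib algebra_simps add_divide_distrib)
    qed (use base lin quad in auto)
    also have "\<dots> = (\<integral>x. (g x)\<^sup>2 - u x * ((1 + sin (w x)) / 2) \<partial>?L) +
       (e * (\<integral>x. 2 * (g x * \<phi> x) - u x * cos (w x) * \<eta> x / 2 \<partial>?L) + e\<^sup>2 * (\<integral>x. (\<phi> x)\<^sup>2 + B * M\<^sup>2 / 2 \<partial>?L))"
      by (subst Bochner_Integration.integral_add[OF base],
          (intro Bochner_Integration.integrable_add integrable_mult_right lin quad),
          subst Bochner_Integration.integral_add[OF integrable_mult_right[OF lin] integrable_mult_right[OF quad]])
        (simp only: integral_mult_right_zero)
    finally show ?thesis by simp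
  qed
  then show ?thesis
    using M(1) unfolding g_def by (intro linear_le_quadratic_imp_zero[of "1 / M"]) auto
qed

section \<open>From the weak equation to classical regularity\<close>

text \<open>The du Bois-Reymond argument with the defect \<open>w' - G\<close> itself as test
  derivative: it is orthogonal to itself and vanishes almost everywhere. As \<open>G\<close> is
  continuous, \<open>w\<close> is a classical primitive of it at every point.\<close>

lemma solution_W_regularity:
  assumes sol: "solution_W u w"
    and u[measurable]: "u \<in> borel_measurable (lebesgue_on {0..1})"
    and B: "\<And>x. x \<in> {0..1} \<Longrightarrow> \<bar>u x\<bar> \<le> B" "0 \<le> B"
    and P: "finite P" "\<And>x. x \<in> {0..1} - P \<Longrightarrow> isCont u x"
  defines "c \<equiv> \<lambda>x. - (1/4) * u x * cos (w x)"
  shows "c absolutely_integrable_on {0..1}" "continuous_on {0..1} (\<lambda>x. integral {0..x} c)"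
    "integral {0..1} c = 0"
    "\<And>x. x \<in> {0..1} \<Longrightarrow> (w has_real_derivative integral {0..x} c) (at x within {0..1})"
proof -
  let ?L = "lebesgue_on {0..1::real}"
  define g where "g = ivl_deriv 0 1 w"
  have ac: "absolutely_continuous_on {0..1} w"
    using sol by (auto simp: solution_W_def admissible_W_def)
  have wc: "continuous_on {0..1} w" by (rule absolutely_continuous_on_imp_continuous_on[OF ac])
  have dw: "AE x in ?L. (w has_real_derivative g x) (at x within {0..1})"
    and [measurable]: "g \<in> borel_measurable ?L"
    using absolutely_continuous_on_FTC[OF ac] by (auto simp: g_def)
  have g2: "integrable ?L (\<lambda>x. (g x)\<^sup>2)"
    unfolding g_def by (rule solution_W_square_integrable[OF sol u B(1)])
  have [measurable]: "w \<in> borel_measurable ?L"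
    using wc by (auto intro!: continuous_imp_measurable_on_sets_lebesgue)
  have [measurable]: "c \<in> borel_measurable ?L" unfolding c_def by measurable
  have cB: "\<bar>c x\<bar> \<le> B" if "x \<in> {0..1}" for x
  proof -
    have "\<bar>c x\<bar> \<le> 1 * B * 1"
      unfolding c_def abs_mult using B that by (intro mult_mono abs_cos_le_one) auto
    then show ?thesis by simp
  qed
  have cint: "integrable ?L c" using cB by (intro integrable_lebesgue_on_bounded) auto
  show cabs: "c absolutely_integrable_on {0..1}"
    using cint by (simp add: set_integrable_def integrable_restrict_space)
  then have con: "c integrable_on {0..1}" by (rule set_lebesgue_integral_eq_integral(1))
  define G where "G x = integral {0..x} c" for x
  have G0: "G 0 = 0" by (simp add: G_def)
  have GL: "\<bar>G x - G y\<bar> \<le> B * \<bar>x - y\<bar>" if "x \<in> {0..1}" "y \<in> {0..1}" for x y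
    unfolding G_def by (rule integral_Lipschitz[OF con cB that])
  have Gac: "absolutely_continuous_on {0..1} G" using GL by (rule absolutely_continuous_on_Lipschitz)
  then have Gc: "continuous_on {0..1} G" by (rule absolutely_continuous_on_imp_continuous_on)
  then show "continuous_on {0..1} (\<lambda>x. integral {0..x} c)" by (simp add: G_def[abs_def])
  have [measurable]: "G \<in> borel_measurable ?L"
    using Gc by (auto intro!: continuous_imp_measurable_on_sets_lebesgue)
  have GB: "\<bar>G x\<bar> \<le> B" if "x \<in> {0..1}" for x
  proof -
    have "\<bar>G x\<bar> \<le> B * \<bar>x\<bar>" using GL[OF that, of 0] by (simp add: G0)
    also have "\<dots> \<le> B * 1" using that B by (intro mult_left_mono) auto
    finally show ?thesis by simp
  qed
  \<comment> \<open>Off the finite set \<open>P\<close> the integrand \<open>c\<close> is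
    continuous, so its primitive is differentiable there with derivative \<open>c\<close>.\<close>
  have dG: "AE x in ?L. (G has_real_derivative c x) (at x within {0..1})"
  proof (rule AE_lebesgue_on_negligible)
    show "negligible P" using P(1) by (rule negligible_finite)
    fix x assume x: "x \<in> {0..1} - P"
    have "continuous (at x within {0..1}) u" using P(2)[OF x] by (rule continuous_at_imp_continuous_at_within)
    moreover have "continuous (at x within {0..1}) w" using wc x by (auto simp: continuous_on_eq_continuous_within)
    ultimately have "continuous (at x within {0..1}) c" unfolding c_def by (intro continuous_intros)
    then show "(G has_real_derivative c x) (at x within {0..1})"
      using integral_has_vector_derivative_continuous_at[OF con, of x "{}"] x
      by (simp add: G_def[abs_def] has_real_derivative_iff_has_vector_derivative)
  qed simp
  \<comment> \<open>A constant test function is allowed because the endpoint values are free; this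
    is the source of the natural condition at 1.\<close>
  have "(\<integral>x. 2 * (ivl_deriv 0 1 w x * 0) - u x * cos (w x) * 1 / 2 \<partial>?L) = 0"
    using absolutely_continuous_on_Lipschitz[of "{0..1}" "\<lambda>x. 1" 0]
    by (intro solution_W_Euler_weak[OF sol u B]) auto
  then have "(\<integral>x. 2 * c x \<partial>?L) = 0" by (simp add: c_def)
  then have "integral\<^sup>L ?L c = 0" by simp
  then have G1: "G 1 = 0" using lebesgue_integral_eq_integral[OF cint] by (simp add: G_def)
  then show "integral {0..1} c = 0" by (simp add: G_def)
  define Q where "Q x = integral {0..x} G" for x
  have Gon: "G integrable_on {0..1}" using Gc by (rule integrable_continuous_real)
  have QL: "\<bar>Q x - Q y\<bar> \<le> B * \<bar>x - y\<bar>" if "x \<in> {0..1}" "y \<in> {0..1}" for x y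
    unfolding Q_def by (rule integral_Lipschitz[OF Gon GB that])
  have dQ: "(Q has_real_derivative G x) (at x within {0..1})" if "x \<in> {0..1}" for x
    unfolding Q_def[abs_def] by (rule integral_has_real_derivative[OF Gc that])
  define \<eta> where "\<eta> x = w x - w 0 - Q x" for x
  define \<phi> where "\<phi> x = g x - G x" for x
  have \<eta>ac: "absolutely_continuous_on {0..1} \<eta>"
    by (rule absolutely_continuous_on_dominated[OF ac absolutely_continuous_on_Lipschitz[OF QL], where B = 1])
      (auto simp: \<eta>_def)
  have d\<eta>: "AE x in ?L. (\<eta> has_real_derivative \<phi> x) (at x within {0..1})"
    using dw AE_space
  proof eventually_elim
    case (elim x)
    then show ?case unfolding \<eta>_def[abs_def] \<phi>_def
      by (auto intro!: derivative_eq_intros dQ)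
  qed
  have [measurable]: "\<phi> \<in> borel_measurable ?L" unfolding \<phi>_def[abs_def] by measurable
  \<comment> \<open>\<open>G\<close> is bounded, so \<open>\<phi>\<close> inherits square
    integrability from \<open>g\<close> and is a legitimate test derivative.\<close>
  have G2: "integrable ?L (\<lambda>x. (G x)\<^sup>2)"
  proof (rule integrable_lebesgue_on_bounded[of _ _ _ "B\<^sup>2"])
    show "\<bar>(G x)\<^sup>2\<bar> \<le> B\<^sup>2" if "x \<in> {0..1}" for x
      using GB[OF that] B by (simp add: abs_le_square_iff[symmetric])
  qed simp
  have gG: "integrable ?L (\<lambda>x. g x * G x)" using g2 G2 by (intro integrable_mult_square_integrable) auto
  have "(\<lambda>x. (\<phi> x)\<^sup>2) = (\<lambda>x. (g x)\<^sup>2 - 2 * (g x * G x) + (G x)\<^sup>2)"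
    by (auto simp: \<phi>_def power2_eq_square algebra_simps)
  then have \<phi>2: "integrable ?L (\<lambda>x. (\<phi> x)\<^sup>2)" using g2 G2 gG by auto
  have g\<phi>: "integrable ?L (\<lambda>x. g x * \<phi> x)" "integrable ?L (\<lambda>x. G x * \<phi> x)"
    using g2 G2 \<phi>2 by (auto intro!: integrable_mult_square_integrable)
  have \<eta>c: "continuous_on {0..1} \<eta>" by (rule absolutely_continuous_on_imp_continuous_on[OF \<eta>ac])
  then have [measurable]: "\<eta> \<in> borel_measurable ?L"
    by (auto intro!: continuous_imp_measurable_on_sets_lebesgue)
  have "bounded (\<eta> ` {0..1})"
    using \<eta>c by (intro compact_imp_bounded compact_continuous_image) auto
  then obtain M where M: "M > 0" "\<And>x. x \<in> {0..1} \<Longrightarrow> \<bar>\<eta> x\<bar> \<le> M"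
    by (auto simp: bounded_pos)
  have c\<eta>: "integrable ?L (\<lambda>x. c x * \<eta> x)"
  proof (rule integrable_lebesgue_on_bounded)
    show "\<bar>c x * \<eta> x\<bar> \<le> B * M" if "x \<in> {0..1}" for x
      unfolding abs_mult using B(2) cB[OF that] M(2)[OF that] by (intro mult_mono) auto
  qed simp
  \<comment> \<open>Integration by parts: the product rule integrated over \<open>[0, 1]\<close>,
    with boundary terms removed by \<open>G0\<close> and \<open>G1\<close>.\<close>
  have "absolutely_continuous_on {0..1} (\<lambda>x. G x * \<eta> x)"
    by (rule absolutely_continuous_on_mult[OF Gac \<eta>ac, where M = "max B M"])
      (use GB M in \<open>auto simp: le_max_iff_disj\<close>)
  moreover have "AE x in ?L. ((\<lambda>x. G x * \<eta> x) has_real_derivative (c x * \<eta> x + G x * \<phi> x)) (at x within {0..1})"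
    using dG d\<eta> by eventually_elim (auto intro!: derivative_eq_intros)
  ultimately have "(\<integral>x. c x * \<eta> x + G x * \<phi> x \<partial>?L) = G 1 * \<eta> 1 - G 0 * \<eta> 0"
    using c\<eta> g\<phi> by (intro absolutely_continuous_on_integral_deriv) auto
  then have parts: "(\<integral>x. c x * \<eta> x \<partial>?L) + (\<integral>x. G x * \<phi> x \<partial>?L) = 0"
    using c\<eta> g\<phi> by (simp add: G0 G1)
  have "(\<integral>x. 2 * (g x * \<phi> x) - u x * cos (w x) * \<eta> x / 2 \<partial>?L) = 0"
    unfolding g_def by (rule solution_W_Euler_weak[OF sol u B \<eta>ac d\<eta> _ \<phi>2]) measurable
  moreover have "(\<lambda>x. 2 * (g x * \<phi> x) - u x * cos (w x) * \<eta> x / 2) = (\<lambda>x. 2 * (g x * \<phi> x) + 2 * (c x * \<eta> x))"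
    by (auto simp: c_def)
  ultimately have "(\<integral>x. g x * \<phi> x \<partial>?L) + (\<integral>x. c x * \<eta> x \<partial>?L) = 0"
    using c\<eta> g\<phi> by simp
  \<comment> \<open>Subtraction eliminates the term with \<open>c\<close> and leaves the integral of
    \<open>(g x - G x) * \<phi> x\<close>, a square.\<close>
  with parts have "(\<integral>x. g x * \<phi> x \<partial>?L) - (\<integral>x. G x * \<phi> x \<partial>?L) = 0" by simp
  then have "(\<integral>x. g x * \<phi> x - G x * \<phi> x \<partial>?L) = 0" using g\<phi> by simp
  moreover have "(\<lambda>x. g x * \<phi> x - G x * \<phi> x) = (\<lambda>x. (\<phi> x)\<^sup>2)"
    by (auto simp: \<phi>_def power2_eq_square algebra_simps)
  ultimately have "(\<integral>x. (\<phi> x)\<^sup>2 \<partial>?L) = 0" by simp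
  then have "AE x in ?L. g x = G x"
    using integral_nonneg_eq_0_iff_AE[OF \<phi>2] by (simp add: \<phi>_def)
  then obtain N where N: "negligible N" "\<And>x. x \<in> {0..1} - N \<Longrightarrow> g x = G x"
    by (rule AE_lebesgue_on_negligibleE) auto
  \<comment> \<open>The fundamental theorem does not see the negligible set where \<open>g\<close>
    and \<open>G\<close> differ, so the identity holds at every point and can be differentiated
    everywhere.\<close>
  have wQ: "w x = w 0 + Q x" if "x \<in> {0..1}" for x
  proof -
    have "(g has_integral (w x - w 0)) {0..x}"
      using absolutely_continuous_on_FTC(3)[OF ac _ that] by (simp add: g_def)
    then have "(G has_integral (w x - w 0)) {0..x}"
      by (rule has_integral_spike[OF N(1), rotated]) (use N(2) that in auto)
    then show ?thesis by (simp add: Q_def integral_unique)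
  qed
  show "(w has_real_derivative integral {0..x} c) (at x within {0..1})" if "x \<in> {0..1}" for x
  proof (rule has_field_derivative_transform_within[of "\<lambda>x. w 0 + Q x" _ _ _ 1])
    show "((\<lambda>x. w 0 + Q x) has_real_derivative integral {0..x} c) (at x within {0..1})"
      using DERIV_add[OF DERIV_const dQ[OF that], of "w 0"] by (simp add: G_def)
    show "w 0 + Q y = w y" if "y \<in> {0..1}" for y using wQ[OF that] by simp
  qed (use that in auto)
qed

theorem theorem2:
  fixes u w :: "real \<Rightarrow> real" and N :: nat and t :: "nat \<Rightarrow> real"
  assumes "piecewise_continuous_wrt N t u"
    and "solution_W u w"
  shows "(\<forall>x\<in>{0..1}. \<not> continuous (at x within {0..1}) u \<longrightarrow> C1_at_within w x {0..1})
    \<and> (AE x in lebesgue_on {0..1}.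
         (w has_real_derivative (LINT s:{0..x}|lebesgue. - (1/4) * u s * cos (w s)))
           (at x within {0..1}))
    \<and> (w has_real_derivative 0) (at 0 within {0..1})
    \<and> (w has_real_derivative 0) (at 1 within {0..1})"
proof -
  obtain B P where BP: "finite P" "0 \<le> B" "\<And>x. x \<in> {0..1} \<Longrightarrow> \<bar>u x\<bar> \<le> B"
    "\<And>x. x \<in> {0..1} - P \<Longrightarrow> isCont u x"
    using piecewise_continuous_bounded[OF assms(1)] by metis
  have u: "u \<in> borel_measurable (lebesgue_on {0..1})"
    using BP(1,4) by (rule borel_measurable_lebesgue_on_finite_exceptions)
  define c where "c x = - (1/4) * u x * cos (w x)" for x
  define G where "G x = integral {0..x} c" for x
  note reg = solution_W_regularity[OF assms(2) u BP(3,2,1,4), folded c_def]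
  have cabs: "c absolutely_integrable_on {0..1}" and Gc: "continuous_on {0..1} G"
    and G01: "G 0 = 0" "G 1 = 0"
    using reg(1-3) by (simp_all add: G_def[abs_def] c_def[abs_def])
  have dw: "(w has_real_derivative G x) (at x within {0..1})" if "x \<in> {0..1}" for x
    using reg(4)[OF _ _ that] by (simp add: G_def c_def[abs_def])
  \<comment> \<open>Converts the gauge integral that defines \<open>G\<close> into the Lebesgue
    integral of the statement.\<close>
  have LINT: "(LINT s:{0..x}|lebesgue. c s) = G x" if "x \<in> {0..1}" for x
    unfolding G_def
    by (rule set_lebesgue_integral_eq_integral(2)[OF set_integrable_subset[OF cabs]]) (use that in auto)
  \<comment> \<open>The derivative is the continuous \<open>G\<close> throughout
    \<open>[0, 1]\<close>, so any radius serves; 1 is taken.\<close>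
  have "C1_at_within w x {0..1}" if "x \<in> {0..1}" for x
    unfolding C1_at_within_def
  proof (intro exI[of _ 1] conjI ballI)
    show "w differentiable (at s within {0..1})" if "s \<in> {0..1} \<inter> ball x 1" for s
      using dw[of s] that real_differentiable_def by blast
    have "continuous_on ({0..1} \<inter> ball x 1) G" using Gc by (rule continuous_on_subset) simp
    then show "continuous_on ({0..1} \<inter> ball x 1) (ivl_deriv 0 1 w)"
      by (rule continuous_on_eq) (use ivl_deriv_eq[OF dw] in auto)
  qed simp
  moreover have "AE x in lebesgue_on {0..1}. (w has_real_derivative (LINT s:{0..x}|lebesgue. c s)) (at x within {0..1})"
    using dw LINT by (auto intro!: AE_I2)
  \<comment> \<open>The two boundary conditions are the values \<open>G 0 = 0\<close> and
    \<open>G 1 = 0\<close>.\<close>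
  ultimately show ?thesis using dw[of 0] dw[of 1] G01 by (simp add: c_def)
qed

end
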